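(* Let $S\subset\mathbf{R}^d$ be a Gutkin billiard table. Every geodesic curve of $S$ which at some point $p$ is tangent to a principal direction of $S$ lies in the 2-plane through $p$ spanned by this direction and the normal line to $S$ at $p$. Moreover, this geodesic is tangent to a principal direction of $S$ at every point of it.
   Context: A Gutkin billiard table in $\mathbf{R}^d$ is a smooth closed hypersurface $S$ bounding a compact convex domain, with all principal curvatures strictly positive everywhere, for which there exists $\delta\in(0,\pi/2)$ such that for every pair of distinct points $p,q\in S$: if the angle between $\overrightarrow{pq}$ and $T_pS$ equals $\delta$, then the angle between $\overrightarrow{pq}$ and $T_qS$ also equals $\delta$. A principal direction at $p$ is an eigenvector of the shape operator of $S$ at $p$. *)

theory Defs
  imports "HOL-Analysis.Analysis"
begin

coinductive C_infinity_on :: "'a::euclidean_space set \<Rightarrow> ('a \<Rightarrow> 'b::real_normed_vector) \<Rightarrow> bool"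
  for U where
  "(\<forall>x\<in>U. f differentiable (at x)) \<Longrightarrow>
   (\<forall>v. C_infinity_on U (\<lambda>x. frechet_derivative f (at x) v)) \<Longrightarrow> C_infinity_on U f"

definition grad :: "('a::euclidean_space \<Rightarrow> real) \<Rightarrow> 'a \<Rightarrow> 'a" where
  "grad F x = (\<Sum>b\<in>Basis. frechet_derivative F (at x) b *\<^sub>R b)"

text \<open>The hypersurface is the regular level set S = {F = 0}; all notions below are
  taken relative to the defining function F.\<close>
definition hsurf :: "('a::euclidean_space \<Rightarrow> real) \<Rightarrow> 'a set" where
  "hsurf F = {x. F x = 0}"

definition tangent_space :: "('a::euclidean_space \<Rightarrow> real) \<Rightarrow> 'a \<Rightarrow> 'a set" where
  "tangent_space F p = {v. frechet_derivative F (at p) v = 0}"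

text \<open>Outward unit normal (Gauss map), F < 0 inside the domain.\<close>
definition unit_normal :: "('a::euclidean_space \<Rightarrow> real) \<Rightarrow> 'a \<Rightarrow> 'a" where
  "unit_normal F x = grad F x /\<^sub>R norm (grad F x)"

definition shape_operator :: "('a::euclidean_space \<Rightarrow> real) \<Rightarrow> 'a \<Rightarrow> 'a \<Rightarrow> 'a" where
  "shape_operator F p = frechet_derivative (unit_normal F) (at p)"

definition principal_direction :: "('a::euclidean_space \<Rightarrow> real) \<Rightarrow> 'a \<Rightarrow> 'a \<Rightarrow> bool" where
  "principal_direction F p v \<longleftrightarrow> v \<in> tangent_space F p \<and> v \<noteq> 0 \<and>
     (\<exists>c. shape_operator F p v = c *\<^sub>R v)"

definition positive_principal_curvatures :: "('a::euclidean_space \<Rightarrow> real) \<Rightarrow> bool" where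
  "positive_principal_curvatures F \<longleftrightarrow> (\<forall>p\<in>hsurf F. \<forall>v c.
     v \<in> tangent_space F p \<and> v \<noteq> 0 \<and> shape_operator F p v = c *\<^sub>R v \<longrightarrow> c > 0)"

definition smooth_convex_hypersurface :: "('a::euclidean_space \<Rightarrow> real) \<Rightarrow> bool" where
  "smooth_convex_hypersurface F \<longleftrightarrow> C_infinity_on UNIV F \<and>
     (\<forall>x\<in>hsurf F. grad F x \<noteq> 0) \<and>
     compact {x. F x \<le> 0} \<and> convex {x. F x \<le> 0} \<and>
     positive_principal_curvatures F"

definition angle_to_hyperplane :: "'a::euclidean_space \<Rightarrow> 'a \<Rightarrow> real" where
  "angle_to_hyperplane w n = arcsin (\<bar>w \<bullet> n\<bar> / (norm w * norm n))"

definition gutkin_table :: "('a::euclidean_space \<Rightarrow> real) \<Rightarrow> bool" where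
  "gutkin_table F \<longleftrightarrow> smooth_convex_hypersurface F \<and>
     (\<exists>\<delta>. 0 < \<delta> \<and> \<delta> < pi / 2 \<and>
        (\<forall>p\<in>hsurf F. \<forall>q\<in>hsurf F. p \<noteq> q \<longrightarrow>
           angle_to_hyperplane (q - p) (unit_normal F p) = \<delta> \<longrightarrow>
           angle_to_hyperplane (q - p) (unit_normal F q) = \<delta>))"

definition velocity :: "(real \<Rightarrow> 'a::real_normed_vector) \<Rightarrow> real \<Rightarrow> 'a" where
  "velocity \<gamma> t = vector_derivative \<gamma> (at t)"

definition acceleration :: "(real \<Rightarrow> 'a::real_normed_vector) \<Rightarrow> real \<Rightarrow> 'a" where
  "acceleration \<gamma> t = vector_derivative (velocity \<gamma>) (at t)"

definition geodesic_on :: "('a::euclidean_space \<Rightarrow> real) \<Rightarrow> real set \<Rightarrow> (real \<Rightarrow> 'a) \<Rightarrow> bool" where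
  "geodesic_on F I \<gamma> \<longleftrightarrow> C_infinity_on I \<gamma> \<and> (\<forall>t\<in>I. \<gamma> t \<in> hsurf F) \<and>
     (\<forall>t\<in>I. \<forall>w\<in>tangent_space F (\<gamma> t). acceleration \<gamma> t \<bullet> w = 0)"

end

theory Submission
  imports Defs
begin

text \<open>
  Let \<open>\<gamma>\<close> be a unit speed geodesic with velocity \<open>v\<close> and normal \<open>n\<close>, and let
  \<open>w = cos \<delta> v - sin \<delta> n\<close>. The chord from \<open>\<gamma>\<close> in direction \<open>w\<close> of length \<open>L\<close> ends at
  \<open>q = \<gamma> + L w\<close>, and the Gutkin condition reads \<open>w = cos \<delta> u + sin \<delta> m\<close> with \<open>m\<close> the normal at
  \<open>q\<close> and \<open>u\<close> a unit tangent vector there. The chord map is symplectic and preserves the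
  hypersurface of tangent vectors of length \<open>cos \<delta>\<close>, hence its characteristics, which are the
  geodesics: \<open>q' = \<rho> u\<close> and \<open>u' = \<nu> m\<close>.

  Now fix \<open>z\<close> orthogonal to \<open>v\<close> and \<open>n\<close> at the initial time \<open>t0\<close>. Since
  \<open>w \<bullet> z = (q - \<gamma>) \<bullet> z / L\<close>, the numbers \<open>n \<bullet> z\<close> and \<open>m \<bullet> z\<close> are linear combinations of
  \<open>(\<gamma> - \<gamma> t0) \<bullet> z\<close>, \<open>v \<bullet> z\<close>, \<open>(q - \<gamma> t0) \<bullet> z\<close> and \<open>u \<bullet> z\<close>, so the latter four
  functions solve a homogeneous linear system of ordinary differential equations. If \<open>v\<close> is
  principal at \<open>t0\<close>, all four vanish there, hence everywhere; so \<open>\<gamma>\<close> and \<open>n\<close> stay in the plane,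
  and then \<open>n'\<close>, being orthogonal to \<open>n\<close> in that plane, is a multiple of \<open>v\<close>.
\<close>

section \<open>Calculus\<close>

lemma C_infinity_on_differentiable:
  assumes "C_infinity_on U f" "x \<in> U"
  shows "f differentiable (at x)"
  using assms by (cases rule: C_infinity_on.cases) auto

lemma C_infinity_on_frechet_derivative:
  assumes "C_infinity_on U f"
  shows "C_infinity_on U (\<lambda>x. frechet_derivative f (at x) v)"
  using assms by (cases rule: C_infinity_on.cases) auto

section \<open>Symmetry of second derivatives\<close>

text \<open>The mean value theorem is used twice: in direction \<open>v\<close> for the difference
  \<open>\<phi>\<close> along two parallel lines, then in direction \<open>w\<close> for the
  derivative so obtained.\<close>

lemma second_difference_mvt:
  fixes F :: "'a::real_normed_vector \<Rightarrow> real"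
  assumes d1: "\<And>x. (F has_derivative F' x) (at x)"
    and d2: "\<And>x v. ((\<lambda>x. F' x v) has_derivative F'' x v) (at x)"
    and "h > 0"
  obtains \<xi> \<eta> where "0 < \<xi>" "\<xi> < h" "0 < \<eta>" "\<eta> < h"
    "F (x + h *\<^sub>R v + h *\<^sub>R w) - F (x + h *\<^sub>R v) - F (x + h *\<^sub>R w) + F x
      = h * h * F'' (x + \<xi> *\<^sub>R v + \<eta> *\<^sub>R w) v w"
proof -
  define \<phi> where "\<phi> = (\<lambda>a. F (x + a *\<^sub>R v + h *\<^sub>R w) - F (x + a *\<^sub>R v))"
  have lin: "F' y (a *\<^sub>R u) = a * F' y u" "F'' y z (a *\<^sub>R u) = a * F'' y z u" for y z a u
    using has_derivative_linear[OF d1, of y] has_derivative_linear[OF d2, of y z]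
    by (auto simp: linear_scale)
  have der: "(\<phi> has_real_derivative
      F' (x + a *\<^sub>R v + h *\<^sub>R w) v - F' (x + a *\<^sub>R v) v) (at a)" for a
    unfolding \<phi>_def has_field_derivative_def
    by (rule has_derivative_eq_rhs, (rule derivative_eq_intros has_derivative_compose[OF _ d1] refl)+)
       (auto simp: fun_eq_iff lin algebra_simps)
  obtain \<xi> where \<xi>: "0 < \<xi>" "\<xi> < h"
    "\<phi> h - \<phi> 0 = h * (F' (x + \<xi> *\<^sub>R v + h *\<^sub>R w) v - F' (x + \<xi> *\<^sub>R v) v)"
    using MVT2[OF \<open>h > 0\<close>, of \<phi> "\<lambda>a. F' (x + a *\<^sub>R v + h *\<^sub>R w) v - F' (x + a *\<^sub>R v) v"] der
    by auto
  define \<psi> where "\<psi> = (\<lambda>b. F' (x + \<xi> *\<^sub>R v + b *\<^sub>R w) v)"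
  have der: "(\<psi> has_real_derivative F'' (x + \<xi> *\<^sub>R v + b *\<^sub>R w) v w) (at b)" for b
    unfolding \<psi>_def has_field_derivative_def
    by (rule has_derivative_eq_rhs, (rule derivative_eq_intros has_derivative_compose[OF _ d2] refl)+)
       (auto simp: fun_eq_iff lin algebra_simps)
  obtain \<eta> where \<eta>: "0 < \<eta>" "\<eta> < h"
    "\<psi> h - \<psi> 0 = h * F'' (x + \<xi> *\<^sub>R v + \<eta> *\<^sub>R w) v w"
    using MVT2[OF \<open>h > 0\<close>, of \<psi> "\<lambda>b. F'' (x + \<xi> *\<^sub>R v + b *\<^sub>R w) v w"] der by auto
  have "\<phi> h - \<phi> 0 = h * (h * F'' (x + \<xi> *\<^sub>R v + \<eta> *\<^sub>R w) v w)"
    using \<xi>(3) \<eta>(3) by (simp add: \<psi>_def)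
  then show ?thesis
    using \<xi> \<eta> by (intro that[of \<xi> \<eta>]) (auto simp: \<phi>_def algebra_simps)
qed

text \<open>The second difference does not change when \<open>v\<close> and \<open>w\<close> are
  exchanged. Computed in both orders, it equates a value of \<open>F''\<close> on \<open>v\<close>,
  \<open>w\<close> with a value on \<open>w\<close>, \<open>v\<close> at two points arbitrarily
  close to \<open>x\<close>, and continuity at \<open>x\<close> does the rest.\<close>

lemma second_derivative_symmetric:
  fixes F :: "'a::real_normed_vector \<Rightarrow> real"
  assumes d1: "\<And>x. (F has_derivative F' x) (at x)"
    and d2: "\<And>x v. ((\<lambda>x. F' x v) has_derivative F'' x v) (at x)"
    and cont: "\<And>v w. isCont (\<lambda>x. F'' x v w) x"
  shows "F'' x v w = F'' x w v"
proof (rule ccontr)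
  assume ne: "F'' x v w \<noteq> F'' x w v"
  define e where "e = \<bar>F'' x v w - F'' x w v\<bar> / 2"
  have "e > 0" using ne by (simp add: e_def)
  obtain r1 where r1: "r1 > 0" "\<And>y. dist y x < r1 \<Longrightarrow> \<bar>F'' y v w - F'' x v w\<bar> < e"
    using cont[of v w, unfolded continuous_at_eps_delta] \<open>e > 0\<close> unfolding dist_real_def by blast
  obtain r2 where r2: "r2 > 0" "\<And>y. dist y x < r2 \<Longrightarrow> \<bar>F'' y w v - F'' x w v\<bar> < e"
    using cont[of w v, unfolded continuous_at_eps_delta] \<open>e > 0\<close> unfolding dist_real_def by blast
  \<comment> \<open>The sample points differ from \<open>x\<close> by at most
    \<open>h * (norm v + norm w)\<close> and so stay within both radii; the summand \<open>1\<close>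
    keeps the denominator positive.\<close>
  define h where "h = min r1 r2 / (norm v + norm w + 1)"
  have "h > 0" using r1 r2 by (auto simp: h_def intro!: divide_pos_pos add_nonneg_pos)
  have "norm v + norm w + 1 > 0" by (intro add_nonneg_pos) auto
  then have hr: "h * (norm v + norm w + 1) = min r1 r2"
    unfolding h_def by simp
  have small: "dist (x + \<xi> *\<^sub>R a + \<eta> *\<^sub>R b) x < min r1 r2"
    if "0 < \<xi>" "\<xi> < h" "0 < \<eta>" "\<eta> < h" "norm a + norm b = norm v + norm w" for \<xi> \<eta> a b
  proof -
    have "dist (x + \<xi> *\<^sub>R a + \<eta> *\<^sub>R b) x \<le> \<xi> * norm a + \<eta> * norm b"
      using norm_triangle_ineq[of "\<xi> *\<^sub>R a" "\<eta> *\<^sub>R b"] that by (simp add: dist_norm algebra_simps)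
    also have "\<dots> \<le> h * norm a + h * norm b"
      using that by (intro add_mono mult_right_mono) auto
    also have "\<dots> < h * (norm v + norm w + 1)"
      using that \<open>h > 0\<close> by (simp add: distrib_left[symmetric])
    finally show ?thesis using hr by simp
  qed
  obtain \<xi> \<eta> where 1: "0 < \<xi>" "\<xi> < h" "0 < \<eta>" "\<eta> < h"
    "F (x + h *\<^sub>R v + h *\<^sub>R w) - F (x + h *\<^sub>R v) - F (x + h *\<^sub>R w) + F x
      = h * h * F'' (x + \<xi> *\<^sub>R v + \<eta> *\<^sub>R w) v w"
    by (rule second_difference_mvt[OF d1 d2 \<open>h > 0\<close>])
  obtain \<xi>' \<eta>' where 2: "0 < \<xi>'" "\<xi>' < h" "0 < \<eta>'" "\<eta>' < h"
    "F (x + h *\<^sub>R w + h *\<^sub>R v) - F (x + h *\<^sub>R w) - F (x + h *\<^sub>R v) + F x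
      = h * h * F'' (x + \<xi>' *\<^sub>R w + \<eta>' *\<^sub>R v) w v"
    by (rule second_difference_mvt[OF d1 d2 \<open>h > 0\<close>])
  have "h * h * F'' (x + \<xi> *\<^sub>R v + \<eta> *\<^sub>R w) v w = h * h * F'' (x + \<xi>' *\<^sub>R w + \<eta>' *\<^sub>R v) w v"
    using 1(5) 2(5) by (simp add: algebra_simps)
  then have "F'' (x + \<xi> *\<^sub>R v + \<eta> *\<^sub>R w) v w = F'' (x + \<xi>' *\<^sub>R w + \<eta>' *\<^sub>R v) w v"
    using \<open>h > 0\<close> by simp
  moreover have "\<bar>F'' (x + \<xi> *\<^sub>R v + \<eta> *\<^sub>R w) v w - F'' x v w\<bar> < e"
    using small[OF 1(1-4), of v w] r1 by auto
  moreover have "\<bar>F'' (x + \<xi>' *\<^sub>R w + \<eta>' *\<^sub>R v) w v - F'' x w v\<bar> < e"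
    using small[OF 2(1-4), of w v] r2 by auto
  ultimately show False unfolding e_def by (auto simp: abs_if split: if_splits)
qed

section \<open>Implicit functions and moving lines\<close>

text \<open>A derivative in \<open>t\<close> is available only at \<open>t0\<close> and for
  \<open>l = l0\<close>, so the root \<open>L t\<close> comes from the intermediate value theorem in
  \<open>l\<close>, without continuity in \<open>t\<close>. The mean value theorem in
  \<open>l\<close> then gives \<open>L t - l0 = - G t l0 / Gl t (\<xi> t)\<close>, from which the
  derivative at \<open>t0\<close> follows.\<close>

lemma implicit_function_real_pos:
  fixes G Gl :: "real \<Rightarrow> real \<Rightarrow> real"
  assumes dl: "\<And>t l. (G t has_real_derivative Gl t l) (at l)"
    and cont: "isCont (\<lambda>z. Gl (fst z) (snd z)) (t0, l0)"
    and dt: "((\<lambda>t. G t l0) has_real_derivative gt) (at t0)"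
    and zero: "G t0 l0 = 0" and pos: "Gl t0 l0 > 0"
  obtains L where "L t0 = l0" "eventually (\<lambda>t. G t (L t) = 0) (nhds t0)"
    "(L has_real_derivative - gt / Gl t0 l0) (at t0)"
proof -
  define m where "m = Gl t0 l0 / 2"
  have "m > 0" using pos by (simp add: m_def)
  obtain d where d: "d > 0" "\<And>z. dist z (t0, l0) < d \<Longrightarrow> \<bar>Gl (fst z) (snd z) - Gl t0 l0\<bar> < m"
    using cont \<open>m > 0\<close> unfolding continuous_at_eps_delta dist_real_def by (metis fst_conv snd_conv)
  define r where "r = d / 3"
  have "r > 0" using d by (simp add: r_def)
  have Gl_gt: "Gl t l > m" if "\<bar>t - t0\<bar> < r" "\<bar>l - l0\<bar> \<le> r" for t l
  proof -
    have "dist (t, l) (t0, l0) \<le> \<bar>t - t0\<bar> + \<bar>l - l0\<bar>"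
      using sqrt_sum_squares_le_sum_abs by (simp add: dist_Pair_Pair dist_real_def)
    also have "\<dots> < d" using that \<open>r > 0\<close> by (simp add: r_def)
    finally have "\<bar>Gl t l - Gl t0 l0\<bar> < m" using d(2)[of "(t, l)"] by simp
    then show ?thesis by (simp add: m_def abs_if split: if_splits)
  qed
  have mvt: "\<exists>\<xi>. \<bar>\<xi> - l0\<bar> \<le> \<bar>l - l0\<bar> \<and> G t l - G t l0 = (l - l0) * Gl t \<xi>" for t l
  proof (cases l l0 rule: linorder_cases)
    case less
    from MVT2[OF less, of "G t" "Gl t"] dl obtain z where "l < z" "z < l0"
      "G t l0 - G t l = (l0 - l) * Gl t z" by blast
    then show ?thesis by (intro exI[of _ z]) (auto simp: algebra_simps)
  next
    case greater
    from MVT2[OF greater, of "G t" "Gl t"] dl obtain z where "l0 < z" "z < l"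
      "G t l - G t l0 = (l - l0) * Gl t z" by blast
    then show ?thesis by (intro exI[of _ z]) auto
  qed auto
  have cont_t: "isCont (\<lambda>t. G t l0) t0" using dt by (rule DERIV_isCont)
  \<comment> \<open>Over a step \<open>r\<close> in \<open>l\<close> the value of \<open>G t\<close>
    changes by more than \<open>m * r\<close>, so this bound forces a sign change between
    \<open>l0 - r\<close> and \<open>l0 + r\<close>.\<close>
  then obtain r' where r': "r' > 0" "\<And>t. \<bar>t - t0\<bar> < r' \<Longrightarrow> \<bar>G t l0\<bar> < m * r"
    using \<open>m > 0\<close> \<open>r > 0\<close> zero unfolding continuous_at_eps_delta dist_real_def
    by (metis diff_zero mult_pos_pos)
  define R where "R = min r r'"
  have R: "R > 0" "R \<le> r" "R \<le> r'" using \<open>r > 0\<close> r' by (auto simp: R_def)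
  have ex: "\<exists>l. \<bar>l - l0\<bar> \<le> r \<and> G t l = 0" if "\<bar>t - t0\<bar> < R" for t
  proof -
    have b: "\<bar>G t l0\<bar> < m * r" and tr: "\<bar>t - t0\<bar> < r" using that R r' by auto
    obtain \<xi> where \<xi>: "\<bar>\<xi> - l0\<bar> \<le> r" "G t (l0 + r) - G t l0 = r * Gl t \<xi>"
      using mvt[of "l0 + r" t] \<open>r > 0\<close> by auto
    obtain \<eta> where \<eta>: "\<bar>\<eta> - l0\<bar> \<le> r" "G t (l0 - r) - G t l0 = - r * Gl t \<eta>"
      using mvt[of "l0 - r" t] \<open>r > 0\<close> by auto
    have "r * m < r * Gl t \<xi>" "r * m < r * Gl t \<eta>"
      using Gl_gt[OF tr \<xi>(1)] Gl_gt[OF tr \<eta>(1)] \<open>r > 0\<close> by auto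
    then have "G t (l0 - r) \<le> 0" "0 \<le> G t (l0 + r)"
      using b \<xi>(2) \<eta>(2) by (auto simp: mult.commute)
    then obtain l where "l0 - r \<le> l" "l \<le> l0 + r" "G t l = 0"
      using IVT[of "G t" "l0 - r" 0 "l0 + r"] dl \<open>r > 0\<close> by (auto dest: DERIV_isCont)
    then show ?thesis by (intro exI[of _ l]) auto
  qed
  then obtain L where L: "\<And>t. \<bar>t - t0\<bar> < R \<Longrightarrow> \<bar>L t - l0\<bar> \<le> r \<and> G t (L t) = 0"
    by metis
  have "\<forall>t. \<exists>\<xi>. \<bar>\<xi> - l0\<bar> \<le> \<bar>L t - l0\<bar> \<and> G t (L t) - G t l0 = (L t - l0) * Gl t \<xi>"
    using mvt by blast
  then obtain \<xi> where \<xi>: "\<And>t. \<bar>\<xi> t - l0\<bar> \<le> \<bar>L t - l0\<bar> \<and> G t (L t) - G t l0 = (L t - l0) * Gl t (\<xi> t)"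
    by metis
  have near: "eventually (\<lambda>t. \<bar>t - t0\<bar> < R) (nhds t0)"
    using R by (auto simp: eventually_nhds_metric dist_real_def)
  have Glx: "Gl t (\<xi> t) > m" if "\<bar>t - t0\<bar> < R" for t
    using L[OF that] \<xi>[of t] R that by (intro Gl_gt) auto
  have Leq: "L t - l0 = - G t l0 / Gl t (\<xi> t)" if "\<bar>t - t0\<bar> < R" for t
    using L[OF that] \<xi>[of t] Glx[OF that] \<open>m > 0\<close> by (simp add: field_simps)
  have L0: "L t0 = l0" using Leq[of t0] R zero by simp
  have Lb: "\<bar>L t - l0\<bar> \<le> \<bar>G t l0\<bar> / m" if "\<bar>t - t0\<bar> < R" for t
    using Leq[OF that] Glx[OF that] \<open>m > 0\<close> by (auto simp: abs_divide intro!: divide_left_mono)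
  have "((\<lambda>t. \<bar>G t l0\<bar> / m) \<longlongrightarrow> \<bar>G t0 l0\<bar> / m) (at t0)"
    using cont_t \<open>m > 0\<close> by (intro tendsto_intros) (auto simp: isCont_def)
  then have lim0: "((\<lambda>t. \<bar>G t l0\<bar> / m) \<longlongrightarrow> 0) (at t0)" using zero by simp
  have nat: "eventually (\<lambda>t. \<bar>t - t0\<bar> < R) (at t0)"
    using near by (simp add: eventually_nhds_conv_at)
  \<comment> \<open>\<open>\<xi> t\<close> is no further from \<open>l0\<close> than
    \<open>L t\<close>, whose distance from \<open>l0\<close> is at most
    \<open>\<bar>G t l0\<bar> / m\<close>.\<close>
  have "((\<lambda>t. \<xi> t - l0) \<longlongrightarrow> 0) (at t0)"
  proof (rule Lim_null_comparison[OF _ lim0])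
    show "eventually (\<lambda>t. norm (\<xi> t - l0) \<le> \<bar>G t l0\<bar> / m) (at t0)"
      using nat
    proof eventually_elim
      case (elim t)
      then show ?case using \<xi>[of t] Lb[of t] by auto
    qed
  qed
  then have "(\<xi> \<longlongrightarrow> l0) (at t0)" using LIM_zero_iff by blast
  then have "((\<lambda>t. (t, \<xi> t)) \<longlongrightarrow> (t0, l0)) (at t0)" by (intro tendsto_intros)
  then have limGl: "((\<lambda>t. Gl t (\<xi> t)) \<longlongrightarrow> Gl t0 l0) (at t0)"
    using isCont_tendsto_compose[OF cont] by force
  have "((\<lambda>t. (G t l0 - G t0 l0) / (t - t0)) \<longlongrightarrow> gt) (at t0)"
    using dt by (simp add: has_field_derivative_iff)
  then have "((\<lambda>t. - ((G t l0 - G t0 l0) / (t - t0)) / Gl t (\<xi> t)) \<longlongrightarrow> - gt / Gl t0 l0) (at t0)"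
    using limGl pos by (intro tendsto_intros) auto
  then have "((\<lambda>t. (L t - L t0) / (t - t0)) \<longlongrightarrow> - gt / Gl t0 l0) (at t0)"
  proof (rule Lim_transform_eventually)
    show "eventually (\<lambda>t. - ((G t l0 - G t0 l0) / (t - t0)) / Gl t (\<xi> t) = (L t - L t0) / (t - t0)) (at t0)"
      using nat by eventually_elim (simp add: Leq L0 zero)
  qed
  then have "(L has_real_derivative - gt / Gl t0 l0) (at t0)"
    by (simp add: has_field_derivative_iff)
  moreover have "eventually (\<lambda>t. G t (L t) = 0) (nhds t0)"
    using near by eventually_elim (use L in auto)
  ultimately show ?thesis using that L0 by blast
qed

lemma implicit_function_real:
  fixes G Gl :: "real \<Rightarrow> real \<Rightarrow> real"
  assumes dl: "\<And>t l. (G t has_real_derivative Gl t l) (at l)"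
    and cont: "isCont (\<lambda>z. Gl (fst z) (snd z)) (t0, l0)"
    and dt: "((\<lambda>t. G t l0) has_real_derivative gt) (at t0)"
    and zero: "G t0 l0 = 0" and ne: "Gl t0 l0 \<noteq> 0"
  obtains L where "L t0 = l0" "eventually (\<lambda>t. G t (L t) = 0) (nhds t0)"
    "(L has_real_derivative - gt / Gl t0 l0) (at t0)"
proof (cases "Gl t0 l0 > 0")
  case True
  then show ?thesis using implicit_function_real_pos[OF dl cont dt zero] that by blast
next
  case False
  have "isCont (\<lambda>z. - Gl (fst z) (snd z)) (t0, l0)" using cont by (intro continuous_intros)
  then obtain L where "L t0 = l0" "eventually (\<lambda>t. - G t (L t) = 0) (nhds t0)"
    "(L has_real_derivative - (- gt) / (- Gl t0 l0)) (at t0)"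
    using implicit_function_real_pos[of "\<lambda>t l. - G t l" "\<lambda>t l. - Gl t l" t0 l0 "- gt",
        OF DERIV_minus[OF dl] _ DERIV_minus[OF dt]] zero ne False by auto
  then show ?thesis using that by simp
qed

text \<open>The implicit function theorem for a moving line that crosses the level set transversally
  at \<open>t0\<close>. It serves both for differentiable chord lengths and for building curves on
  the hypersurface with prescribed velocity.\<close>

lemma level_set_meets_moving_line:
  fixes F :: "'a::euclidean_space \<Rightarrow> real"
  assumes dF: "\<And>x. (F has_derivative (\<lambda>v. g x \<bullet> v)) (at x)"
    and g: "\<And>x. isCont g x"
    and x: "(x has_vector_derivative x') (at t0)"
    and u: "(u has_vector_derivative u') (at t0)"
    and zero: "F (x t0 + l0 *\<^sub>R u t0) = 0"
    and ne: "g (x t0 + l0 *\<^sub>R u t0) \<bullet> u t0 \<noteq> 0"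
  obtains L L' where "L t0 = l0" "eventually (\<lambda>t. F (x t + L t *\<^sub>R u t) = 0) (nhds t0)"
    "(L has_real_derivative L') (at t0)"
proof -
  define G where "G = (\<lambda>t l. F (x t + l *\<^sub>R u t))"
  define Gl where "Gl = (\<lambda>t l. g (x t + l *\<^sub>R u t) \<bullet> u t)"
  have dl: "(G t has_real_derivative Gl t l) (at l)" for t l
    unfolding G_def Gl_def has_field_derivative_def
    by (rule has_derivative_eq_rhs, (rule derivative_eq_intros has_derivative_compose[OF _ dF] refl)+)
       (auto simp: fun_eq_iff)
  have cx: "isCont x t0" "isCont u t0"
    using x u by (auto intro: has_vector_derivative_continuous)
  have cf: "isCont (\<lambda>z. x (fst z)) (t0, l0)" "isCont (\<lambda>z. u (fst z)) (t0, l0)"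
    using cx by (auto intro!: isCont_o2[OF isCont_fst[OF continuous_ident]])
  then have "isCont (\<lambda>z. x (fst z) + snd z *\<^sub>R u (fst z)) (t0, l0)"
    by (intro continuous_intros)
  then have "isCont (\<lambda>z. g (x (fst z) + snd z *\<^sub>R u (fst z))) (t0, l0)"
    using g by (rule isCont_o2)
  then have cont: "isCont (\<lambda>z. Gl (fst z) (snd z)) (t0, l0)"
    unfolding Gl_def using cf by (intro continuous_intros)
  have dt: "((\<lambda>t. G t l0) has_real_derivative g (x t0 + l0 *\<^sub>R u t0) \<bullet> (x' + l0 *\<^sub>R u')) (at t0)"
    unfolding G_def has_field_derivative_def
    by (rule has_derivative_eq_rhs, (rule derivative_eq_intros has_derivative_compose[OF _ dF]
          x[unfolded has_vector_derivative_def] u[unfolded has_vector_derivative_def] refl)+)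
       (auto simp: fun_eq_iff algebra_simps)
  show ?thesis
    using implicit_function_real[OF dl cont dt] zero ne that unfolding G_def Gl_def by metis
qed

section \<open>Gronwall's inequality\<close>

text \<open>The product of \<open>E\<close> with \<open>exp (- M * t)\<close> starts at zero and
  does not increase.\<close>

lemma gronwall_zero_forward:
  fixes E E' :: "real \<Rightarrow> real"
  assumes "t0 \<le> t1" and dE: "\<And>t. t \<in> {t0..t1} \<Longrightarrow> (E has_real_derivative E' t) (at t)"
    and le: "\<And>t. t \<in> {t0..t1} \<Longrightarrow> E' t \<le> M * E t"
    and "E t0 = 0" and "E t1 \<ge> 0"
  shows "E t1 = 0"
proof -
  define f where "f = (\<lambda>t. E t * exp (- M * t))"
  have "(f has_real_derivative (E' t - M * E t) * exp (- M * t)) (at t)" if "t \<in> {t0..t1}" for t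
    unfolding f_def using dE[OF that]
    by (auto intro!: derivative_eq_intros simp: algebra_simps)
  then have "f t1 \<le> f t0"
    using \<open>t0 \<le> t1\<close> le
    by (intro DERIV_nonpos_imp_nonincreasing[of t0 t1 f])
       (auto intro!: exI mult_nonpos_nonneg)
  then have "E t1 * exp (- M * t1) \<le> 0" using \<open>E t0 = 0\<close> by (simp add: f_def)
  then show ?thesis using \<open>E t1 \<ge> 0\<close> by (simp add: mult_le_0_iff)
qed

text \<open>The bound on \<open>E'\<close> is two-sided so that time can be reversed when
  \<open>t1 < t0\<close>; the continuous \<open>M\<close> is replaced by a bound on the compact
  interval between the two times.\<close>

lemma gronwall_zero:
  fixes E E' :: "real \<Rightarrow> real"
  assumes "t0 \<in> {a<..<b}" "t1 \<in> {a<..<b}"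
    and dE: "\<And>t. t \<in> {a<..<b} \<Longrightarrow> (E has_real_derivative E' t) (at t)"
    and le: "\<And>t. t \<in> {a<..<b} \<Longrightarrow> \<bar>E' t\<bar> \<le> M t * E t"
    and M: "continuous_on {a<..<b} M"
    and "E t0 = 0" and pos: "\<And>t. E t \<ge> 0"
  shows "E t1 = 0"
proof -
  define J where "J = {min t0 t1..max t0 t1}"
  have J: "J \<subseteq> {a<..<b}" using assms(1,2) by (auto simp: J_def)
  have "compact (M ` J)"
    using M J by (intro compact_continuous_image) (auto simp: J_def intro: continuous_on_subset)
  then obtain B where B: "\<And>t. t \<in> J \<Longrightarrow> M t \<le> B"
    by (meson bdd_above.E bounded_imp_bdd_above compact_imp_bounded image_eqI)
  have le': "\<bar>E' t\<bar> \<le> B * E t" if "t \<in> J" for t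
    using le[of t] mult_right_mono[OF B[OF that] pos[of t]] J that by auto
  show ?thesis
  proof (cases "t0 \<le> t1")
    case True
    show ?thesis
      by (rule gronwall_zero_forward[OF True, of E E' B])
         (use True J dE le' pos assms(6) in \<open>force simp: J_def\<close>)+
  next
    case False
    have "E (- (- t1)) = 0"
    proof (rule gronwall_zero_forward[of "- t0" "- t1" "\<lambda>t. E (- t)" "\<lambda>t. - E' (- t)" B])
      fix t assume t: "t \<in> {- t0..- t1}"
      then have tJ: "- t \<in> J" using False by (auto simp: J_def)
      show "((\<lambda>t. E (- t)) has_real_derivative - E' (- t)) (at t)"
        using dE[of "- t"] tJ J DERIV_mirror[of E "- E' (- t)" t]
        by (metis DERIV_mirror minus_minus subsetD)
      show "- E' (- t) \<le> B * E (- t)" using le'[OF tJ] by (simp add: abs_if split: if_splits)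
    qed (use False assms(6) pos in auto)
    then show ?thesis by simp
  qed
qed

section \<open>Normalised fields and derivatives along curves\<close>

text \<open>Differentiating the factor \<open>inverse (norm (f x))\<close> removes exactly the
  component of \<open>f' v\<close> along \<open>f x\<close>.\<close>

lemma has_derivative_normalize:
  fixes f :: "'a::real_normed_vector \<Rightarrow> 'b::real_inner"
  assumes f: "(f has_derivative f') (at x)" and ne: "f x \<noteq> 0"
  shows "((\<lambda>x. f x /\<^sub>R norm (f x)) has_derivative
    (\<lambda>v. (f' v - ((f x /\<^sub>R norm (f x)) \<bullet> f' v) *\<^sub>R (f x /\<^sub>R norm (f x))) /\<^sub>R norm (f x))) (at x)"
proof -
  have nd: "((\<lambda>x. norm (f x)) has_derivative (\<lambda>v. sgn (f x) \<bullet> f' v)) (at x)"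
    using has_derivative_compose[OF f has_derivative_norm[OF ne]]
    by (simp add: inner_commute)
  show ?thesis
    by (rule has_derivative_eq_rhs,
        rule has_derivative_scaleR[OF Deriv.has_derivative_inverse[OF _ nd] f])
       (use ne in \<open>auto simp: fun_eq_iff sgn_div_norm algebra_simps\<close>)
qed

lemma has_vector_derivative_compose_has_derivative:
  assumes "(x has_vector_derivative x') (at t)" and "(f has_derivative f') (at (x t))"
  shows "((\<lambda>t. f (x t)) has_vector_derivative f' x') (at t)"
proof -
  have "((\<lambda>t. f (x t)) has_derivative (\<lambda>h. f' (h *\<^sub>R x'))) (at t)"
    using has_derivative_compose[OF assms(1)[unfolded has_vector_derivative_def] assms(2)] .
  moreover have "(\<lambda>h. f' (h *\<^sub>R x')) = (\<lambda>h. h *\<^sub>R f' x')"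
    using has_derivative_linear[OF assms(2)] by (simp add: linear_scale)
  ultimately show ?thesis by (simp add: has_vector_derivative_def)
qed

lemma has_vector_derivative_inner:
  assumes "(f has_vector_derivative f') (at t)" and "(g has_vector_derivative g') (at t)"
  shows "((\<lambda>t. f t \<bullet> g t) has_real_derivative (f' \<bullet> g t + f t \<bullet> g')) (at t)"
proof -
  have "((\<lambda>t. f t \<bullet> g t) has_derivative (\<lambda>h. f t \<bullet> (h *\<^sub>R g') + (h *\<^sub>R f') \<bullet> g t)) (at t)"
    using assms unfolding has_vector_derivative_def by (rule has_derivative_inner)
  then show ?thesis
    unfolding has_field_derivative_def
    by (rule has_derivative_eq_rhs) (auto simp: fun_eq_iff algebra_simps)
qed

text \<open>This turns constraints along a curve, such as unit length or a fixed angle, into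
  relations between derivatives.\<close>

lemma DERIV_eventually_const:
  assumes "(f has_real_derivative D) (at t)" and "eventually (\<lambda>t. f t = k) (nhds t)"
  shows "D = (0::real)"
proof -
  have "((\<lambda>_. k) has_real_derivative D) (at t)"
    using assms(1) by (rule DERIV_cong_ev[OF refl assms(2) refl, THEN iffD1])
  then show ?thesis using DERIV_const DERIV_unique by blast
qed

lemma frechet_derivative_eq_vector_derivative:
  assumes "f differentiable (at t)"
  shows "frechet_derivative f (at t) 1 = vector_derivative f (at t)"
  using frechet_derivative_at[of f "\<lambda>h. h *\<^sub>R vector_derivative f (at t)" t] assms
  by (metis has_vector_derivative_def scaleR_one vector_derivative_works)

text \<open>\<open>C_infinity_on\<close> speaks of Frechet derivatives, \<open>velocity\<close> and
  \<open>acceleration\<close> of vector derivatives. They agree on \<open>I\<close>, and openness of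
  \<open>I\<close> lets the derivative of one pass to the other.\<close>

lemma C_infinity_on_curve:
  fixes \<gamma> :: "real \<Rightarrow> 'a::real_normed_vector"
  assumes \<gamma>: "C_infinity_on I \<gamma>" and "open I"
  shows "\<And>t. t \<in> I \<Longrightarrow> (\<gamma> has_vector_derivative velocity \<gamma> t) (at t)"
    and "\<And>t. t \<in> I \<Longrightarrow> (velocity \<gamma> has_vector_derivative acceleration \<gamma> t) (at t)"
    and "continuous_on I (acceleration \<gamma>)"
proof -
  define f1 where "f1 = (\<lambda>t. frechet_derivative \<gamma> (at t) 1)"
  define f2 where "f2 = (\<lambda>t. frechet_derivative f1 (at t) 1)"
  have C1: "C_infinity_on I f1"
    unfolding f1_def by (rule C_infinity_on_frechet_derivative[OF \<gamma>])
  have C2: "C_infinity_on I f2"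
    unfolding f2_def by (rule C_infinity_on_frechet_derivative[OF C1])
  have eq1: "f1 t = velocity \<gamma> t" if "t \<in> I" for t
    unfolding f1_def velocity_def
    by (rule frechet_derivative_eq_vector_derivative[OF C_infinity_on_differentiable[OF \<gamma> that]])
  have "(f1 has_vector_derivative f2 t) (at t)" if "t \<in> I" for t
    using C_infinity_on_differentiable[OF C1 that]
    by (simp add: f2_def frechet_derivative_eq_vector_derivative vector_derivative_works[symmetric])
  then have d2: "(velocity \<gamma> has_vector_derivative f2 t) (at t)" if "t \<in> I" for t
    using that eq1 has_vector_derivative_transform_within_open[of f1 "f2 t" t I "velocity \<gamma>"]
      \<open>open I\<close> by blast
  then have eq2: "acceleration \<gamma> t = f2 t" if "t \<in> I" for t
    using that by (simp add: acceleration_def vector_derivative_at)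
  show "(\<gamma> has_vector_derivative velocity \<gamma> t) (at t)" if "t \<in> I" for t
    using C_infinity_on_differentiable[OF \<gamma> that]
    by (simp add: velocity_def vector_derivative_works[symmetric])
  show "(velocity \<gamma> has_vector_derivative acceleration \<gamma> t) (at t)" if "t \<in> I" for t
    using d2[OF that] eq2[OF that] by simp
  have "continuous_on I f2"
    using C_infinity_on_differentiable[OF C2]
    by (auto intro!: continuous_at_imp_continuous_on differentiable_imp_continuous_within)
  then show "continuous_on I (acceleration \<gamma>)"
    using eq2 by (simp cong: continuous_on_cong)
qed

section \<open>Planes in Euclidean space and a quadratic estimate\<close>

text \<open>The component of \<open>z\<close> orthogonal to the span is an admissible
  \<open>w\<close>; being orthogonal to \<open>z\<close>, it is orthogonal to itself.\<close>

lemma in_span_pairI: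
  fixes x y z :: "'a::euclidean_space"
  assumes "\<And>w. w \<bullet> x = 0 \<Longrightarrow> w \<bullet> y = 0 \<Longrightarrow> z \<bullet> w = 0"
  shows "z \<in> span {x, y}"
proof -
  obtain z1 z2 where z: "z1 \<in> span {x, y}" "\<And>w. w \<in> span {x, y} \<Longrightarrow> orthogonal z2 w" "z = z1 + z2"
    using orthogonal_subspace_decomp_exists[of "{x, y}" z] by metis
  have "z2 \<bullet> x = 0" "z2 \<bullet> y = 0"
    using z(2) by (auto simp: orthogonal_def span_base)
  then have "z \<bullet> z2 = 0" by (rule assms)
  moreover have "z1 \<bullet> z2 = 0" using z(1,2) by (simp add: orthogonal_def inner_commute)
  ultimately have "z2 = 0" using z(3) by (simp add: inner_add_left)
  then show ?thesis using z by simp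
qed

text \<open>Two nonzero orthogonal vectors already have the largest dimension that two generators
  can span.\<close>

lemma span_orthogonal_pair_eq:
  fixes x y :: "'a::euclidean_space"
  assumes "x \<noteq> 0" "y \<noteq> 0" "x \<bullet> y = 0" and "x \<in> span {v, w}" "y \<in> span {v, w}"
  shows "span {x, y} = span {v, w}"
proof (rule subspace_dim_equal)
  show "span {x, y} \<subseteq> span {v, w}" using assms by (intro span_minimal) auto
  have "x \<noteq> y" using assms by auto
  moreover have "independent {x, y}"
    using assms by (intro pairwise_orthogonal_independent)
      (auto simp: pairwise_def orthogonal_def inner_commute)
  ultimately have "dim {x, y} = 2" by (simp add: dim_eq_card_independent)
  moreover have "dim {v, w} \<le> card {v, w}" by (intro dim_le_card') auto
  moreover have "card {v, w} \<le> 2" by (simp add: card_insert_if)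
  ultimately show "dim (span {v, w}) \<le> dim (span {x, y})" by simp
qed auto

text \<open>The left side is the time derivative of the sum of squares of \<open>x1\<close> to
  \<open>x4\<close> under the linear system for a geodesic and its chord; \<open>l\<close> is the
  chord length, \<open>s\<close> and \<open>c\<close> are sine and cosine of \<delta>. Every product
  of two unknowns is bounded by that sum, so the coefficients simply add up.\<close>

lemma quadratic_energy_bound:
  fixes x1 x2 x3 x4 \<sigma> \<alpha> \<rho> \<nu> l s c :: real
  assumes "s > 0" "c > 0" "l > 0" "\<sigma> > 0"
  shows "\<bar>2 * (x1 * (\<sigma> * x2) + x2 * (\<alpha> * ((c * x2 - (x3 - x1) / l) / s)) + x3 * (\<rho> * x4)
      + x4 * (\<nu> * (((x3 - x1) / l - c * x4) / s)))\<bar>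
    \<le> 2 * (\<sigma> + \<bar>\<alpha>\<bar> * ((c + 2 / l) / s) + \<bar>\<rho>\<bar> + \<bar>\<nu>\<bar> * ((c + 2 / l) / s))
      * (x1\<^sup>2 + x2\<^sup>2 + x3\<^sup>2 + x4\<^sup>2)"
proof -
  define E where "E = x1\<^sup>2 + x2\<^sup>2 + x3\<^sup>2 + x4\<^sup>2"
  define B where "B = (c + 2 / l) / s"
  have two: "\<bar>a * b\<bar> \<le> (a\<^sup>2 + b\<^sup>2) / 2" for a b :: real
    using sum_squares_bound[of a b] sum_squares_bound[of a "- b"] by (auto simp: abs_if)
  have sq: "x1\<^sup>2 \<ge> 0" "x2\<^sup>2 \<ge> 0" "x3\<^sup>2 \<ge> 0" "x4\<^sup>2 \<ge> 0" by auto
  have e: "\<bar>x1 * x2\<bar> \<le> E" "\<bar>x2 * x2\<bar> \<le> E" "\<bar>x2 * x3\<bar> \<le> E" "\<bar>x2 * x1\<bar> \<le> E"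
    "\<bar>x3 * x4\<bar> \<le> E" "\<bar>x4 * x3\<bar> \<le> E" "\<bar>x4 * x1\<bar> \<le> E" "\<bar>x4 * x4\<bar> \<le> E"
    using two[of x1 x2] two[of x2 x2] two[of x2 x3] two[of x3 x4] two[of x4 x1] two[of x4 x4] sq
    by (auto simp: E_def mult.commute power2_eq_square[of x2, symmetric] power2_eq_square[of x4, symmetric])
  have q: "\<bar>(c * a + b / l - b' / l) / s\<bar> \<le> B * E"
    if "\<bar>a\<bar> \<le> E" "\<bar>b\<bar> \<le> E" "\<bar>b'\<bar> \<le> E" for a b b'
  proof -
    have "\<bar>c * a + b / l - b' / l\<bar> \<le> c * \<bar>a\<bar> + \<bar>b\<bar> / l + \<bar>b'\<bar> / l"
      using assms abs_triangle_ineq4[of "c * a + b / l" "b' / l"] abs_triangle_ineq[of "c * a" "b / l"]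
      by (simp add: abs_mult abs_divide)
    also have "\<dots> \<le> c * E + E / l + E / l"
      using that assms by (intro add_mono mult_left_mono divide_right_mono) auto
    finally show ?thesis
      using assms by (simp add: B_def abs_divide divide_right_mono field_simps)
  qed
  have t1: "\<bar>x1 * (\<sigma> * x2)\<bar> \<le> \<sigma> * E"
    using e(1) assms by (simp add: abs_mult mult.left_commute)
  have "x2 * ((c * x2 - (x3 - x1) / l) / s) = (c * (x2 * x2) + (x2 * x1) / l - (x2 * x3) / l) / s"
    by (simp add: algebra_simps add_divide_distrib diff_divide_distrib)
  then have "\<bar>x2 * ((c * x2 - (x3 - x1) / l) / s)\<bar> \<le> B * E" using q[OF e(2,4,3)] by (simp only:)
  then have t2: "\<bar>x2 * (\<alpha> * ((c * x2 - (x3 - x1) / l) / s))\<bar> \<le> \<bar>\<alpha>\<bar> * (B * E)"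
    by (subst mult.left_commute, subst abs_mult) (rule mult_left_mono, auto)
  have t3: "\<bar>x3 * (\<rho> * x4)\<bar> \<le> \<bar>\<rho>\<bar> * E"
    using mult_left_mono[OF e(5), of "\<bar>\<rho>\<bar>"] by (simp add: abs_mult mult.left_commute)
  have "x4 * (((x3 - x1) / l - c * x4) / s) = - ((c * (x4 * x4) + (x4 * x1) / l - (x4 * x3) / l) / s)"
    by (simp add: algebra_simps add_divide_distrib diff_divide_distrib)
  then have "\<bar>x4 * (((x3 - x1) / l - c * x4) / s)\<bar> \<le> B * E" using q[OF e(8,7,6)] by (simp only: abs_minus_cancel)
  then have t4: "\<bar>x4 * (\<nu> * (((x3 - x1) / l - c * x4) / s))\<bar> \<le> \<bar>\<nu>\<bar> * (B * E)"
    by (subst mult.left_commute, subst abs_mult) (rule mult_left_mono, auto)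
  have "\<bar>2 * (y1 + y2 + y3 + y4)\<bar> \<le> 2 * (b1 + b2 + b3 + b4)"
    if "\<bar>y1\<bar> \<le> b1" "\<bar>y2\<bar> \<le> b2" "\<bar>y3\<bar> \<le> b3" "\<bar>y4\<bar> \<le> b4" for y1 y2 y3 y4 b1 b2 b3 b4 :: real
    using that by auto
  from this[OF t1 t2 t3 t4] show ?thesis
    unfolding E_def[symmetric] B_def[symmetric] by (simp only: distrib_right mult.assoc)
qed

section \<open>Level sets of smooth functions\<close>

locale smooth_function =
  fixes F :: "'a::euclidean_space \<Rightarrow> real"
  assumes smooth: "C_infinity_on UNIV F"
begin

text \<open>Encoded as the vector derivative of \<open>grad F\<close> in direction \<open>v\<close>;
  the Hessian form is \<open>hess x v \<bullet> w\<close>.\<close>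

definition hess :: "'a \<Rightarrow> 'a \<Rightarrow> 'a" where
  "hess x v = (\<Sum>b\<in>Basis. frechet_derivative (\<lambda>x. frechet_derivative F (at x) b) (at x) v *\<^sub>R b)"

lemma frechet_derivative_eq_grad: "frechet_derivative F (at x) v = grad F x \<bullet> v"
proof -
  have lin: "linear (frechet_derivative F (at x))"
    using C_infinity_on_differentiable[OF smooth] by (intro linear_frechet_derivative) auto
  have "frechet_derivative F (at x) v = frechet_derivative F (at x) (\<Sum>b\<in>Basis. (v \<bullet> b) *\<^sub>R b)"
    by (simp add: euclidean_representation)
  also have "\<dots> = grad F x \<bullet> v"
    by (simp add: linear_sum[OF lin] linear_scale[OF lin] grad_def inner_sum_left
        inner_commute[of v] mult.commute)
  finally show ?thesis .
qed

lemma has_derivative_F: "(F has_derivative (\<lambda>v. grad F x \<bullet> v)) (at x)"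
  using C_infinity_on_differentiable[OF smooth, of x] frechet_derivative_works
  by (metis (no_types, lifting) UNIV_I ext frechet_derivative_eq_grad)

lemma tangent_space_iff: "v \<in> tangent_space F p \<longleftrightarrow> grad F p \<bullet> v = 0"
  by (simp add: tangent_space_def frechet_derivative_eq_grad)

lemma has_derivative_grad: "(grad F has_derivative hess x) (at x)"
proof -
  have d: "((\<lambda>x. frechet_derivative F (at x) b) has_derivative
      frechet_derivative (\<lambda>x. frechet_derivative F (at x) b) (at x)) (at x)" for b
    using C_infinity_on_differentiable[OF C_infinity_on_frechet_derivative[OF smooth], of x]
      frechet_derivative_works by blast
  show ?thesis
    unfolding grad_def[abs_def] hess_def[abs_def]
    by (auto intro!: derivative_eq_intros d)
qed

lemma isCont_grad: "isCont (grad F) x"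
  using has_derivative_continuous[OF has_derivative_grad] .

lemma linear_hess: "linear (hess x)"
  using has_derivative_linear[OF has_derivative_grad] .

lemma isCont_hess: "isCont (\<lambda>x. hess x v) x"
proof -
  have "isCont (\<lambda>x. frechet_derivative (\<lambda>x. frechet_derivative F (at x) b) (at x) v) x" for b
    using C_infinity_on_differentiable[OF C_infinity_on_frechet_derivative[OF
          C_infinity_on_frechet_derivative[OF smooth]], of x]
    by (auto intro: differentiable_imp_continuous_within)
  then show ?thesis unfolding hess_def by (intro continuous_intros)
qed

lemma continuous_on_hess:
  assumes "continuous_on S f" "continuous_on S h"
  shows "continuous_on S (\<lambda>t. hess (f t) (h t))"
proof -
  \<comment> \<open>Linearity in \<open>v\<close> reduces joint continuity to continuity in the base
    point for finitely many fixed directions.\<close>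
  have eq: "hess x v = (\<Sum>b\<in>Basis. (v \<bullet> b) *\<^sub>R hess x b)" for x v
    using linear_sum[OF linear_hess[of x], of "\<lambda>b. (v \<bullet> b) *\<^sub>R b" Basis]
    by (simp add: euclidean_representation linear_scale[OF linear_hess])
  have "continuous_on S (\<lambda>t. hess (f t) b)" for b
    by (rule continuous_on_compose2[of UNIV "\<lambda>x. hess x b", OF _ assms(1)])
       (auto intro!: continuous_at_imp_continuous_on isCont_hess)
  then have "continuous_on S (\<lambda>t. \<Sum>b\<in>Basis. (h t \<bullet> b) *\<^sub>R hess (f t) b)"
    using assms by (intro continuous_intros)
  then show ?thesis by (simp only: eq[symmetric])
qed

lemma hess_symmetric: "hess x v \<bullet> w = hess x w \<bullet> v"
proof -
  have "((\<lambda>x. grad F x \<bullet> v) has_derivative (\<lambda>w. hess x w \<bullet> v)) (at x)" for x v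
    by (auto intro!: derivative_eq_intros has_derivative_grad)
  moreover have "isCont (\<lambda>x. hess x w \<bullet> v) x" for v w
    by (intro continuous_intros isCont_hess)
  ultimately show ?thesis
    using second_derivative_symmetric[OF has_derivative_F, of "\<lambda>x v w. hess x w \<bullet> v" x w v] by blast
qed

section \<open>Unit normal and shape operator\<close>

lemma shape_operator_eq:
  assumes "grad F x \<noteq> 0"
  shows "shape_operator F x v =
    (hess x v - (unit_normal F x \<bullet> hess x v) *\<^sub>R unit_normal F x) /\<^sub>R norm (grad F x)"
    and has_derivative_unit_normal: "(unit_normal F has_derivative shape_operator F x) (at x)"
proof -
  have 1: "(unit_normal F has_derivative (\<lambda>v.
    (hess x v - (unit_normal F x \<bullet> hess x v) *\<^sub>R unit_normal F x) /\<^sub>R norm (grad F x))) (at x)"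
    using has_derivative_normalize[OF has_derivative_grad assms]
    unfolding unit_normal_def[abs_def] .
  from frechet_derivative_at[OF this]
  have 2: "shape_operator F x = (\<lambda>v.
    (hess x v - (unit_normal F x \<bullet> hess x v) *\<^sub>R unit_normal F x) /\<^sub>R norm (grad F x))"
    unfolding shape_operator_def by simp
  show "shape_operator F x v =
    (hess x v - (unit_normal F x \<bullet> hess x v) *\<^sub>R unit_normal F x) /\<^sub>R norm (grad F x)"
    by (simp add: 2)
  show "(unit_normal F has_derivative shape_operator F x) (at x)"
    using 1 2 by simp
qed

lemma unit_normal_inner_self: "grad F x \<noteq> 0 \<Longrightarrow> unit_normal F x \<bullet> unit_normal F x = 1"
  unfolding unit_normal_def by (simp add: power2_norm_eq_inner[symmetric] power2_eq_square)

lemma grad_eq_unit_normal: "grad F x = norm (grad F x) *\<^sub>R unit_normal F x"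
  by (cases "grad F x = 0") (auto simp: unit_normal_def)

lemma grad_inner_zero_iff: "grad F x \<noteq> 0 \<Longrightarrow> grad F x \<bullet> v = 0 \<longleftrightarrow> unit_normal F x \<bullet> v = 0"
  unfolding unit_normal_def by simp

lemma unit_normal_shape_operator:
  assumes "grad F x \<noteq> 0"
  shows "unit_normal F x \<bullet> shape_operator F x v = 0"
  using unit_normal_inner_self[OF assms]
  by (simp add: shape_operator_eq(1)[OF assms] inner_diff_right)

text \<open>On tangent vectors the normal correction in \<open>shape_operator_eq\<close> pairs to
  zero, so the symmetry of the Hessian carries over.\<close>

lemma shape_operator_symmetric:
  assumes "grad F x \<noteq> 0" "unit_normal F x \<bullet> v = 0" "unit_normal F x \<bullet> w = 0"
  shows "shape_operator F x v \<bullet> w = shape_operator F x w \<bullet> v"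
  using assms(2,3) hess_symmetric[of x v w]
  by (simp add: shape_operator_eq(1)[OF assms(1)] inner_diff_left)

lemma continuous_on_grad:
  assumes "continuous_on S f"
  shows "continuous_on S (\<lambda>t. grad F (f t))"
  by (rule continuous_on_compose2[of UNIV "grad F", OF _ assms])
     (auto intro!: continuous_at_imp_continuous_on isCont_grad)

lemma continuous_on_unit_normal:
  assumes "continuous_on S f" "\<And>t. t \<in> S \<Longrightarrow> grad F (f t) \<noteq> 0"
  shows "continuous_on S (\<lambda>t. unit_normal F (f t))"
  unfolding unit_normal_def using assms
  by (intro continuous_intros continuous_on_grad) auto

lemma continuous_on_shape_operator:
  assumes "continuous_on S f" "continuous_on S h" "\<And>t. t \<in> S \<Longrightarrow> grad F (f t) \<noteq> 0"
  shows "continuous_on S (\<lambda>t. shape_operator F (f t) (h t))"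
proof -
  have "continuous_on S (\<lambda>t. (hess (f t) (h t) - (unit_normal F (f t) \<bullet> hess (f t) (h t)) *\<^sub>R unit_normal F (f t))
      /\<^sub>R norm (grad F (f t)))"
    using assms
    by (intro continuous_intros continuous_on_grad continuous_on_unit_normal continuous_on_hess) auto
  then show ?thesis
    using assms(3) by (simp add: shape_operator_eq(1) cong: continuous_on_cong)
qed

end

section \<open>Chords of a Gutkin table\<close>

locale gutkin_billiard = smooth_function +
  fixes \<delta> :: real
  assumes convex_hypersurface: "smooth_convex_hypersurface F"
    and delta: "0 < \<delta>" "\<delta> < pi / 2"
    and gutkin: "\<And>p q. \<lbrakk>F p = 0; F q = 0; p \<noteq> q;
      angle_to_hyperplane (q - p) (unit_normal F p) = \<delta>\<rbrakk> \<Longrightarrow>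
      angle_to_hyperplane (q - p) (unit_normal F q) = \<delta>"
begin

abbreviation "nrm \<equiv> unit_normal F"
abbreviation "shp \<equiv> shape_operator F"

lemma sin_cos_delta: "sin \<delta> > 0" "cos \<delta> > 0"
  using delta by (auto intro!: sin_gt_zero cos_gt_zero)

lemma sin_cos_delta_squares: "sin \<delta> * sin \<delta> + cos \<delta> * cos \<delta> = 1"
  using sin_cos_squared_add[of \<delta>] by (simp add: power2_eq_square)

lemma grad_nonzero: "F x = 0 \<Longrightarrow> grad F x \<noteq> 0"
  using convex_hypersurface by (auto simp: smooth_convex_hypersurface_def hsurf_def)

lemmas nrm_unit = unit_normal_inner_self[OF grad_nonzero]
lemmas nrm_shp = unit_normal_shape_operator[OF grad_nonzero]
lemmas shp_sym = shape_operator_symmetric[OF grad_nonzero]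

section \<open>Supporting hyperplanes; existence, uniqueness and differentiability of chords\<close>

text \<open>By convexity the segment from \<open>p\<close> to \<open>y\<close> stays in the domain,
  so \<open>F\<close>, which vanishes at \<open>p\<close>, cannot increase at its start.\<close>

lemma supporting_hyperplane:
  assumes p: "F p = 0" and y: "F y \<le> 0"
  shows "nrm p \<bullet> (y - p) \<le> 0"
proof -
  define f where "f = (\<lambda>t. F (p + t *\<^sub>R (y - p)))"
  have "((\<lambda>t. p + t *\<^sub>R (y - p)) has_vector_derivative (y - p)) (at 0)"
    by (auto intro!: derivative_eq_intros)
  from has_vector_derivative_compose_has_derivative[OF this has_derivative_F]
  have df: "(f has_real_derivative grad F p \<bullet> (y - p)) (at 0)"
    by (simp add: f_def has_real_derivative_iff_has_vector_derivative)
  have "convex {x. F x \<le> 0}"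
    using convex_hypersurface by (simp add: smooth_convex_hypersurface_def)
  then have le: "f t \<le> 0" if "0 \<le> t" "t \<le> 1" for t
    using convexD_alt[of "{x. F x \<le> 0}" p y t] p y that
    by (simp add: f_def algebra_simps)
  have "\<not> grad F p \<bullet> (y - p) > 0"
  proof
    assume "grad F p \<bullet> (y - p) > 0"
    from DERIV_pos_inc_right[OF df this] obtain d where "d > 0" "\<And>h. 0 < h \<Longrightarrow> h < d \<Longrightarrow> f 0 < f (0 + h)"
      by auto
    \<comment> \<open>This parameter lies both in the range of increase and on the segment.\<close>
    then have "f 0 < f (0 + min (d/2) 1)" by (auto simp: min_def)
    moreover have "f 0 = 0" using p by (simp add: f_def)
    ultimately show False using le[of "min (d/2) 1"] \<open>d > 0\<close> by simp
  qed
  then have "norm (grad F p) * (nrm p \<bullet> (y - p)) \<le> 0"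
    by (metis grad_eq_unit_normal inner_scaleR_left linorder_not_le)
  then show ?thesis using grad_nonzero[OF p] by (simp add: mult_le_0_iff)
qed

lemma angle_eq_delta_iff:
  assumes "norm w = 1" "norm n = 1" "l > 0"
  shows "angle_to_hyperplane (l *\<^sub>R w) n = \<delta> \<longleftrightarrow> \<bar>w \<bullet> n\<bar> = sin \<delta>"
proof -
  have le: "\<bar>w \<bullet> n\<bar> \<le> 1" using Cauchy_Schwarz_ineq2[of w n] assms by simp
  have "angle_to_hyperplane (l *\<^sub>R w) n = arcsin \<bar>w \<bullet> n\<bar>"
    using assms by (simp add: angle_to_hyperplane_def abs_mult)
  moreover have "arcsin \<bar>w \<bullet> n\<bar> = \<delta> \<longleftrightarrow> \<bar>w \<bullet> n\<bar> = sin \<delta>"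
    using le delta sin_arcsin[of "\<bar>w \<bullet> n\<bar>"] by (auto simp: arcsin_sin)
  ultimately show ?thesis by simp
qed

lemma norm_nrm: "F x = 0 \<Longrightarrow> norm (nrm x) = 1"
  using nrm_unit by (simp add: norm_eq_1)

text \<open>The table property leaves the sign open; the supporting hyperplane at the far end,
  tested on \<open>p\<close>, decides it.\<close>

lemma chord_exit_angle:
  assumes p: "F p = 0" and w: "norm w = 1" and "w \<bullet> nrm p = - sin \<delta>"
    and l: "l > 0" and q: "F (p + l *\<^sub>R w) = 0"
  shows "w \<bullet> nrm (p + l *\<^sub>R w) = sin \<delta>"
proof -
  have "p + l *\<^sub>R w \<noteq> p" using w l by auto
  moreover have "angle_to_hyperplane (p + l *\<^sub>R w - p) (nrm p) = \<delta>"
    using angle_eq_delta_iff[OF w norm_nrm[OF p] l] assms(3) sin_cos_delta by simp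
  ultimately have "angle_to_hyperplane (p + l *\<^sub>R w - p) (nrm (p + l *\<^sub>R w)) = \<delta>"
    using gutkin[OF p q] by metis
  then have "\<bar>w \<bullet> nrm (p + l *\<^sub>R w)\<bar> = sin \<delta>"
    using angle_eq_delta_iff[OF w norm_nrm[OF q] l] by simp
  moreover have "w \<bullet> nrm (p + l *\<^sub>R w) \<ge> 0"
    using supporting_hyperplane[OF q, of p] p l by (simp add: inner_commute zero_le_mult_iff)
  ultimately show ?thesis by simp
qed

text \<open>Along the ray \<open>F\<close> first becomes negative and later, outside the bounded
  domain, positive, so the intermediate value theorem applies.\<close>

lemma chord_exists:
  assumes p: "F p = 0" and w: "norm w = 1" and wn: "w \<bullet> nrm p < 0"
  shows "\<exists>l>0. F (p + l *\<^sub>R w) = 0"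
proof -
  define f where "f = (\<lambda>t. F (p + t *\<^sub>R w))"
  have cont: "isCont f t" for t
    unfolding f_def
    by (rule isCont_o2[where g = F]) (intro continuous_intros has_derivative_continuous[OF has_derivative_F])+
  have "((\<lambda>t. p + t *\<^sub>R w) has_vector_derivative w) (at 0)"
    by (auto intro!: derivative_eq_intros)
  from has_vector_derivative_compose_has_derivative[OF this has_derivative_F]
  have df: "(f has_real_derivative grad F p \<bullet> w) (at 0)"
    by (simp add: f_def has_real_derivative_iff_has_vector_derivative)
  have "grad F p \<bullet> w = norm (grad F p) * (nrm p \<bullet> w)"
    using grad_eq_unit_normal[of p] by (metis inner_scaleR_left)
  then have "grad F p \<bullet> w < 0"
    using wn grad_nonzero[OF p] by (simp add: mult_less_0_iff inner_commute)
  from DERIV_neg_dec_right[OF df this] obtain d where d: "d > 0"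
    "\<And>h. 0 < h \<Longrightarrow> h < d \<Longrightarrow> f (0 + h) < f 0" by auto
  then have neg: "f (d/2) < 0" using p d(2)[of "d/2"] by (simp add: f_def)
  have "bounded {x. F x \<le> 0}"
    using convex_hypersurface by (simp add: smooth_convex_hypersurface_def compact_imp_bounded)
  then obtain B where B: "\<And>x. F x \<le> 0 \<Longrightarrow> norm x \<le> B" unfolding bounded_iff by auto
  \<comment> \<open>The point at parameter \<open>T\<close> has norm above \<open>B\<close>, and
    \<open>T\<close> exceeds \<open>d/2\<close>, where \<open>f\<close> is already negative.\<close>
  define T where "T = \<bar>B\<bar> + norm p + d + 1"
  have "T > 0" using d by (simp add: T_def add_nonneg_pos add_pos_pos)
  have "norm (p + T *\<^sub>R w) \<ge> T - norm p"
    using norm_triangle_ineq2[of "T *\<^sub>R w" "- p"] w \<open>T > 0\<close> by (simp add: add.commute)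
  then have "norm (p + T *\<^sub>R w) > B" using d by (simp add: T_def)
  then have "f T \<ge> 0" using B[of "p + T *\<^sub>R w"] unfolding f_def by linarith
  moreover have "d / 2 \<le> T" using d by (simp add: T_def add_nonneg_nonneg)
  ultimately obtain l where "d/2 \<le> l" "l \<le> T" "f l = 0"
    using IVT[of f "d/2" 0 T] neg cont by auto
  then show ?thesis using d by (intro exI[of _ l]) (auto simp: f_def)
qed

text \<open>At the exit point \<open>w\<close> has positive product with the outward normal, so the
  supporting hyperplane there bars any later zero. With \<open>l\<close> and \<open>l'\<close>
  exchanged this gives uniqueness of the chord.\<close>

lemma chord_length_le:
  assumes p: "F p = 0" and w: "norm w = 1" and wn: "w \<bullet> nrm p = - sin \<delta>"
    and "l > 0" "F (p + l *\<^sub>R w) = 0" "F (p + l' *\<^sub>R w) = 0"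
  shows "l' \<le> l"
proof -
  have "nrm (p + l *\<^sub>R w) \<bullet> (p + l' *\<^sub>R w - (p + l *\<^sub>R w)) \<le> 0"
    using assms by (intro supporting_hyperplane) auto
  then have "(l' - l) * (w \<bullet> nrm (p + l *\<^sub>R w)) \<le> 0"
    by (simp add: inner_commute algebra_simps)
  then show ?thesis
    using chord_exit_angle[OF p w wn assms(4,5)] sin_cos_delta by (simp add: mult_le_0_iff)
qed

text \<open>The description is known to be unique for boundary points \<open>p\<close> and unit
  vectors \<open>w\<close> entering at angle \<delta>, the setting of
  \<open>chord_props\<close>.\<close>

definition chord :: "'a \<Rightarrow> 'a \<Rightarrow> real" where
  "chord p w = (THE l. l > 0 \<and> F (p + l *\<^sub>R w) = 0)"

lemma chord_eqI:
  assumes "F p = 0" "norm w = 1" "w \<bullet> nrm p = - sin \<delta>" "l > 0" "F (p + l *\<^sub>R w) = 0"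
  shows "chord p w = l"
  unfolding chord_def using assms chord_length_le[OF assms(1-3)]
  by (intro the_equality) (auto intro: antisym)

lemma chord_props:
  assumes "F p = 0" "norm w = 1" "w \<bullet> nrm p = - sin \<delta>"
  shows "chord p w > 0" "F (p + chord p w *\<^sub>R w) = 0"
    "w \<bullet> nrm (p + chord p w *\<^sub>R w) = sin \<delta>"
proof -
  obtain l where l: "l > 0" "F (p + l *\<^sub>R w) = 0"
    using chord_exists[OF assms(1,2)] assms(3) sin_cos_delta by auto
  with chord_eqI[OF assms] have "chord p w = l" by simp
  with l chord_exit_angle[OF assms l] show "chord p w > 0" "F (p + chord p w *\<^sub>R w) = 0"
    "w \<bullet> nrm (p + chord p w *\<^sub>R w) = sin \<delta>" by auto
qed

text \<open>The exit angle makes the line transversal to the hypersurface, so a differentiable root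
  exists; near \<open>t0\<close> it is positive, and uniqueness identifies it with
  \<open>chord\<close>.\<close>

lemma chord_differentiable:
  assumes x: "(x has_vector_derivative x') (at t0)" and w: "(w has_vector_derivative w') (at t0)"
    and ev: "eventually (\<lambda>t. F (x t) = 0 \<and> norm (w t) = 1 \<and> w t \<bullet> nrm (x t) = - sin \<delta>) (nhds t0)"
  obtains L' where "((\<lambda>t. chord (x t) (w t)) has_real_derivative L') (at t0)"
proof -
  define l0 where "l0 = chord (x t0) (w t0)"
  have at0: "F (x t0) = 0" "norm (w t0) = 1" "w t0 \<bullet> nrm (x t0) = - sin \<delta>"
    using eventually_nhds_x_imp_x[OF ev] by auto
  note c0 = chord_props[OF at0, folded l0_def]
  have "grad F (x t0 + l0 *\<^sub>R w t0) \<bullet> w t0 \<noteq> 0"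
    using c0(3) sin_cos_delta grad_inner_zero_iff[OF grad_nonzero[OF c0(2)]]
    by (auto simp: inner_commute)
  then obtain L L' where L: "L t0 = l0" "eventually (\<lambda>t. F (x t + L t *\<^sub>R w t) = 0) (nhds t0)"
    "(L has_real_derivative L') (at t0)"
    using level_set_meets_moving_line[OF has_derivative_F isCont_grad x w c0(2)] by blast
  have "L \<midarrow>t0\<rightarrow> L t0" using DERIV_isCont[OF L(3)] by (simp add: isCont_def)
  then have "eventually (\<lambda>t. L t > 0) (at t0)"
    using c0(1) L(1) by (simp add: order_tendstoD(1))
  then have "eventually (\<lambda>t. L t > 0) (nhds t0)"
    using c0(1) L(1) by (simp add: eventually_nhds_conv_at)
  then have "eventually (\<lambda>t. L t = chord (x t) (w t)) (nhds t0)"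
    using L(2) ev
  proof eventually_elim
    case (elim t)
    then show ?case using chord_eqI[of "x t" "w t" "L t"] by simp
  qed
  then have "((\<lambda>t. chord (x t) (w t)) has_real_derivative L') (at t0)"
    using L(3) by (rule DERIV_cong_ev[OF refl _ refl, THEN iffD1])
  then show ?thesis using that by blast
qed

section \<open>Variations of points and chords on the hypersurface\<close>

lemma hypersurface_curve:
  assumes x: "(x has_vector_derivative x') (at t)"
    and ev: "eventually (\<lambda>t. F (x t) = 0) (nhds t)"
  shows "nrm (x t) \<bullet> x' = 0"
    and "((\<lambda>t. nrm (x t)) has_vector_derivative shp (x t) x') (at t)"
proof -
  have x0: "F (x t) = 0" using eventually_nhds_x_imp_x[OF ev] .
  have "((\<lambda>t. F (x t)) has_real_derivative grad F (x t) \<bullet> x') (at t)"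
    using has_vector_derivative_compose_has_derivative[OF x has_derivative_F]
    by (simp add: has_real_derivative_iff_has_vector_derivative)
  then have "grad F (x t) \<bullet> x' = 0" using ev by (rule DERIV_eventually_const)
  then show "nrm (x t) \<bullet> x' = 0" using grad_inner_zero_iff[OF grad_nonzero[OF x0]] by simp
  show "((\<lambda>t. nrm (x t)) has_vector_derivative shp (x t) x') (at t)"
    by (rule has_vector_derivative_compose_has_derivative[OF x
          has_derivative_unit_normal[OF grad_nonzero[OF x0]]])
qed

text \<open>A variation of the end point and direction is traced back along the chord: for the
  direction \<open>- W e\<close> the point \<open>Q e\<close> is an entry point, and
  \<open>chord\<close> locates the start \<open>p' e\<close>. \<open>P\<close> and \<open>k\<close>
  are the derivatives of this start and of the chord length; the other relations differentiate its
  lying on the hypersurface, the unit length of \<open>W e\<close> and the angle at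
  \<open>p' e\<close>.\<close>

lemma chord_variation:
  assumes Q: "(Q has_vector_derivative X) (at t)" "Q t = q"
    and W: "(W has_vector_derivative Y) (at t)" "W t = w"
    and ev: "eventually (\<lambda>e. F (Q e) = 0 \<and> norm (W e) = 1 \<and> W e \<bullet> nrm (Q e) = sin \<delta>) (nhds t)"
    and l: "l > 0" "p = q - l *\<^sub>R w" "F p = 0"
  obtains P k where "P = X - k *\<^sub>R w - l *\<^sub>R Y" "nrm p \<bullet> P = 0" "w \<bullet> Y = 0"
    "Y \<bullet> nrm p + w \<bullet> shp p P = 0"
proof -
  have at0: "F q = 0" "norm w = 1" "w \<bullet> nrm q = sin \<delta>"
    using eventually_nhds_x_imp_x[OF ev] Q W by auto
  define L where "L = (\<lambda>e. chord (Q e) (- W e))"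
  have Lt: "L t = l"
    unfolding L_def Q W using at0 l by (intro chord_eqI) auto
  have ev': "eventually (\<lambda>e. F (Q e) = 0 \<and> norm (- W e) = 1 \<and> - W e \<bullet> nrm (Q e) = - sin \<delta>) (nhds t)"
    using ev by eventually_elim simp
  obtain k where k: "(L has_real_derivative k) (at t)"
    unfolding L_def
    by (rule chord_differentiable[OF Q(1) has_vector_derivative_minus[OF W(1)] ev'])
  define p' where "p' = (\<lambda>e. Q e - L e *\<^sub>R W e)"
  define P where "P = X - k *\<^sub>R w - l *\<^sub>R Y"
  have dp: "(p' has_vector_derivative P) (at t)"
    unfolding p'_def P_def
    by (rule derivative_eq_intros k[unfolded has_real_derivative_iff_has_vector_derivative] Q W refl
        has_vector_derivative_scaleR k)+ (simp add: Lt W)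
  have pt: "p' t = p" by (simp add: p'_def Lt Q W l)
  \<comment> \<open>The exit angle belongs to \<open>- W e\<close>, hence the negative sine for
    \<open>W e\<close>; the table property is used here from \<open>Q e\<close> to
    \<open>p' e\<close>.\<close>
  have ep: "eventually (\<lambda>e. F (p' e) = 0 \<and> W e \<bullet> nrm (p' e) = - sin \<delta>) (nhds t)"
    using ev
  proof eventually_elim
    case (elim e)
    then show ?case
      using chord_props[of "Q e" "- W e"] by (simp add: p'_def L_def algebra_simps)
  qed
  then have "eventually (\<lambda>e. F (p' e) = 0) (nhds t)" by eventually_elim simp
  from hypersurface_curve[OF dp this] have 1: "nrm p \<bullet> P = 0"
    and dn: "((\<lambda>e. nrm (p' e)) has_vector_derivative shp p P) (at t)"
    by (simp_all add: pt)
  have "Y \<bullet> nrm (p' t) + W t \<bullet> shp p P = 0"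
    by (rule DERIV_eventually_const[OF has_vector_derivative_inner[OF W(1) dn]])
       (use ep in \<open>auto elim: eventually_mono\<close>)
  moreover have "Y \<bullet> W t + W t \<bullet> Y = 0"
    by (rule DERIV_eventually_const[OF has_vector_derivative_inner[OF W(1) W(1)], where k = 1])
       (use ev in \<open>auto elim: eventually_mono simp: norm_eq_1\<close>)
  ultimately show ?thesis
    using 1 by (intro that[of P k]) (auto simp: P_def pt W inner_commute)
qed

text \<open>Invariance of the canonical two-form \<open>dv \<and> dp\<close> under the chord map, evaluated on the
  geodesic variation \<open>(d, w')\<close>, which lies in the kernel of its restriction to the vectors at angle
  \<open>\<delta>\<close>, and an arbitrary variation \<open>(X, Y)\<close> of the end point and the direction of the chord.\<close>

lemma chord_map_symplectic:
  assumes pq: "F p = 0" "F q = 0" and w: "w \<bullet> w' = 0"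
    and d: "cos \<delta> *\<^sub>R d = \<sigma> *\<^sub>R (w + sin \<delta> *\<^sub>R nrm p)" "nrm p \<bullet> d = 0"
    and w': "w' = \<mu> *\<^sub>R nrm p - sin \<delta> *\<^sub>R shp p d"
    and q': "q' = d + k' *\<^sub>R w + l *\<^sub>R w'" "nrm q \<bullet> q' = 0"
    and u': "cos \<delta> *\<^sub>R u' = w' - sin \<delta> *\<^sub>R shp q q'"
    and P: "P = X - k *\<^sub>R w - l *\<^sub>R Y" "nrm p \<bullet> P = 0" "w \<bullet> Y = 0"
      "Y \<bullet> nrm p + w \<bullet> shp p P = 0"
    and X: "nrm q \<bullet> X = 0"
    and V: "cos \<delta> *\<^sub>R V = Y - sin \<delta> *\<^sub>R shp q X"
  shows "u' \<bullet> X = q' \<bullet> V"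
proof -
  define s c where "s = sin \<delta>" and "c = cos \<delta>"
  have c: "c > 0" using sin_cos_delta by (simp add: c_def)
  \<comment> \<open>Symmetry of \<open>shp q\<close> matches the last terms of the next two
    equations, so the claim reduces to \<open>w' \<bullet> X = q' \<bullet> Y\<close>.\<close>
  have 1: "c * (u' \<bullet> X) = w' \<bullet> X - s * (shp q q' \<bullet> X)"
    using arg_cong[OF u', of "\<lambda>y. y \<bullet> X"] by (simp add: s_def c_def inner_diff_left)
  have 2: "c * (q' \<bullet> V) = q' \<bullet> Y - s * (shp q X \<bullet> q')"
    using arg_cong[OF V, of "\<lambda>y. q' \<bullet> y"] by (simp add: s_def c_def inner_diff_right inner_commute)
  have "X = P + k *\<^sub>R w + l *\<^sub>R Y" using P(1) by simp
  then have 3: "w' \<bullet> X = w' \<bullet> P + l * (w' \<bullet> Y)"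
    using w by (simp add: inner_add_right inner_commute)
  have 4: "q' \<bullet> Y = d \<bullet> Y + l * (w' \<bullet> Y)" using P(3) by (simp add: q'(1) inner_add_left)
  have 5: "w' \<bullet> P = - s * (shp p P \<bullet> d)"
    using P(2) shp_sym[OF pq(1) d(2) P(2)] by (simp add: w' s_def inner_diff_left)
  \<comment> \<open>Inserting \<open>d(1)\<close> makes this a multiple of the differentiated angle
    condition at \<open>p\<close>, which vanishes by \<open>P(4)\<close>.\<close>
  have "c * (s * (shp p P \<bullet> d) + d \<bullet> Y) = s * (shp p P \<bullet> (c *\<^sub>R d)) + (c *\<^sub>R d) \<bullet> Y"
    by (simp add: algebra_simps)
  also have "\<dots> = \<sigma> * (s * (w \<bullet> shp p P) + s * s * (nrm p \<bullet> shp p P) + w \<bullet> Y + s * (Y \<bullet> nrm p))"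
    unfolding d(1)[folded c_def s_def] by (simp add: inner_commute algebra_simps)
  also have "\<dots> = \<sigma> * s * (Y \<bullet> nrm p + w \<bullet> shp p P)"
    using P(3) nrm_shp[OF pq(1)] by (simp add: algebra_simps)
  also have "\<dots> = 0" using P(4) by simp
  finally have "s * (shp p P \<bullet> d) + d \<bullet> Y = 0" using c by simp
  then have "w' \<bullet> X = q' \<bullet> Y" using 3 4 5 by simp
  moreover have "shp q q' \<bullet> X = shp q X \<bullet> q'" using shp_sym[OF pq(2) q'(2) X] .
  ultimately have "c * (u' \<bullet> X) = c * (q' \<bullet> V)" using 1 2 by simp
  then show ?thesis using c by simp
qed

section \<open>Geodesics under the chord map\<close>

lemma chord_norm:
  assumes "norm y = 1" "norm n = 1" "y \<bullet> n = 0"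
  shows "norm (cos \<delta> *\<^sub>R y + sin \<delta> *\<^sub>R n) = 1"
  using assms sin_cos_delta_squares by (simp add: norm_eq_1 algebra_simps inner_commute)

text \<open>By \<open>chord_map_symplectic\<close>, \<open>u' \<bullet> X = q' \<bullet> V\<close>
  for every variation \<open>X\<close>, \<open>V\<close> of the point \<open>q\<close> and the unit
  tangent vector \<open>u\<close>. Rotating \<open>u\<close> at fixed \<open>q\<close> makes
  \<open>q'\<close> parallel to \<open>u\<close>; moving \<open>q\<close> with normal
  \<open>V\<close> makes \<open>u'\<close> normal. These are the geodesic equations up to
  parametrisation.\<close>

lemma reflected_geodesic:
  assumes pq: "F p = 0" "F q = 0" "l > 0" "q = p + l *\<^sub>R w"
    and w: "norm w = 1" "w \<bullet> nrm q = sin \<delta>" "w \<bullet> w' = 0"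
    and d: "cos \<delta> *\<^sub>R d = \<sigma> *\<^sub>R (w + sin \<delta> *\<^sub>R nrm p)" "nrm p \<bullet> d = 0"
    and w': "w' = \<mu> *\<^sub>R nrm p - sin \<delta> *\<^sub>R shp p d"
    and q': "q' = d + k' *\<^sub>R w + l *\<^sub>R w'" "nrm q \<bullet> q' = 0"
    and u: "cos \<delta> *\<^sub>R u = w - sin \<delta> *\<^sub>R nrm q"
    and u': "cos \<delta> *\<^sub>R u' = w' - sin \<delta> *\<^sub>R shp q q'"
  shows "q' = (q' \<bullet> u) *\<^sub>R u" "u' = (u' \<bullet> nrm q) *\<^sub>R nrm q" "norm u = 1" "u \<bullet> nrm q = 0"
proof -
  define s c where "s = sin \<delta>" and "c = cos \<delta>"
  have c: "c > 0" using sin_cos_delta by (simp add: c_def)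
  have weq: "w = c *\<^sub>R u + s *\<^sub>R nrm q" using u by (simp add: s_def c_def)
  have nq: "nrm q \<bullet> nrm q = 1" "norm (nrm q) = 1" using nrm_unit norm_nrm pq by auto
  have "c * (u \<bullet> nrm q) = w \<bullet> nrm q - s * (nrm q \<bullet> nrm q)"
    using arg_cong[OF u, of "\<lambda>y. y \<bullet> nrm q"] by (simp add: s_def c_def inner_diff_left)
  then show un: "u \<bullet> nrm q = 0" using w(2) nq c by (simp add: s_def)
  have "w \<bullet> w = c * c * (u \<bullet> u) + s * s"
    using un nq unfolding weq by (simp add: algebra_simps inner_commute)
  moreover have "w \<bullet> w = 1" using w(1) by (simp add: norm_eq_1)
  moreover have "s * s + c * c = 1" using sin_cos_delta_squares by (simp add: s_def c_def)
  ultimately have "c * c * (u \<bullet> u) = c * c * 1" by linarith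
  then have uu: "u \<bullet> u = 1" using c by simp
  then show nu: "norm u = 1" by (simp add: norm_eq_1)
  have peq: "p = q - l *\<^sub>R w" using pq by simp
  have symp: "u' \<bullet> X = q' \<bullet> V"
    if hyp: "(Q has_vector_derivative X) (at 0)" "Q 0 = q"
      "(U has_vector_derivative V) (at 0)" "U 0 = u"
      "eventually (\<lambda>e. F (Q e) = 0 \<and> norm (U e) = 1 \<and> U e \<bullet> nrm (Q e) = 0) (nhds 0)"
    for Q U :: "real \<Rightarrow> 'a" and X V
  proof -
    \<comment> \<open>The unit tangent vector \<open>U e\<close> at \<open>Q e\<close> determines
      the chord direction that exits there at angle \<delta>.\<close>
    define W where "W = (\<lambda>e. c *\<^sub>R U e + s *\<^sub>R nrm (Q e))"
    define Y where "Y = c *\<^sub>R V + s *\<^sub>R shp q X"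
    have evQ: "eventually (\<lambda>e. F (Q e) = 0) (nhds 0)" using hyp(5) by eventually_elim simp
    note hQ = hypersurface_curve[OF hyp(1) evQ, unfolded hyp(2)]
    have W: "(W has_vector_derivative Y) (at 0)" "W 0 = w"
      unfolding W_def Y_def using weq hyp(2,4)
      by (auto intro!: derivative_eq_intros hyp(3) hQ(2))
    have evW: "eventually (\<lambda>e. F (Q e) = 0 \<and> norm (W e) = 1 \<and> W e \<bullet> nrm (Q e) = sin \<delta>) (nhds 0)"
      using hyp(5)
    proof eventually_elim
      case (elim e)
      then show ?case
        using nrm_unit[of "Q e"] norm_nrm[of "Q e"] chord_norm[of "U e" "nrm (Q e)"]
        by (simp add: W_def s_def c_def inner_add_left)
    qed
    obtain P k where P: "P = X - k *\<^sub>R w - l *\<^sub>R Y" "nrm p \<bullet> P = 0" "w \<bullet> Y = 0"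
      "Y \<bullet> nrm p + w \<bullet> shp p P = 0"
      by (rule chord_variation[OF hyp(1,2) W evW pq(3) peq pq(1)])
    show ?thesis
      by (rule chord_map_symplectic[OF pq(1,2) w(3) d w' q' u' P hQ(1)]) (simp add: Y_def s_def c_def)
  qed
  have A: "q' \<bullet> \<eta> = 0" if "nrm q \<bullet> \<eta> = 0" "u \<bullet> \<eta> = 0" for \<eta>
  proof (cases "\<eta> = 0")
    case False
    define h where "h = \<eta> /\<^sub>R norm \<eta>"
    have h: "h \<bullet> h = 1" "u \<bullet> h = 0" "nrm q \<bullet> h = 0"
      using False that by (auto simp: h_def power2_norm_eq_inner[symmetric] power2_eq_square)
    \<comment> \<open>The variation rotates \<open>u\<close> towards \<open>h\<close> and keeps
      \<open>q\<close> fixed, so \<open>X = 0\<close> and \<open>V = h\<close>.\<close>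
    have "u' \<bullet> 0 = q' \<bullet> h"
    proof (rule symp[of "\<lambda>e. q" 0 "\<lambda>e. cos e *\<^sub>R u + sin e *\<^sub>R h" h])
      show "((\<lambda>e. cos e *\<^sub>R u + sin e *\<^sub>R h) has_vector_derivative h) (at 0)"
        unfolding has_vector_derivative_def
        by (auto intro!: derivative_eq_intros simp: fun_eq_iff)
      have "norm (cos e *\<^sub>R u + sin e *\<^sub>R h) = 1" for e
        using h uu sin_cos_squared_add[of e]
        by (simp add: norm_eq_1 algebra_simps inner_commute power2_eq_square)
      then show "eventually (\<lambda>e. F q = 0 \<and> norm (cos e *\<^sub>R u + sin e *\<^sub>R h) = 1 \<and>
          (cos e *\<^sub>R u + sin e *\<^sub>R h) \<bullet> nrm q = 0) (nhds 0)"
        using pq(2) un h by (simp add: inner_add_left inner_commute[of h "nrm q"])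
    qed auto
    then show ?thesis using False by (simp add: h_def)
  qed auto
  have B: "u' \<bullet> X = 0" if X: "nrm q \<bullet> X = 0" for X
  proof -
    \<comment> \<open>The line through \<open>q\<close> in direction \<open>X\<close> is pushed back
      onto the hypersurface along the fixed vector \<open>nrm q\<close>; as \<open>X\<close> is
      tangent, the correction has derivative zero at \<open>0\<close>.\<close>
    have "((\<lambda>e. q + e *\<^sub>R X) has_vector_derivative X) (at 0)"
      by (auto intro!: derivative_eq_intros)
    moreover have "((\<lambda>e::real. nrm q) has_vector_derivative 0) (at 0)" by simp
    moreover have "F (q + 0 *\<^sub>R X + 0 *\<^sub>R nrm q) = 0" using pq by simp
    moreover have "grad F (q + 0 *\<^sub>R X + 0 *\<^sub>R nrm q) \<bullet> nrm q \<noteq> 0"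
      using grad_inner_zero_iff[OF grad_nonzero[OF pq(2)], of "nrm q"] nq by simp
    ultimately obtain L L' where L: "L 0 = (0::real)"
      "eventually (\<lambda>e. F (q + e *\<^sub>R X + L e *\<^sub>R nrm q) = 0) (nhds 0)"
      "(L has_real_derivative L') (at 0)"
      by (rule level_set_meets_moving_line[OF has_derivative_F isCont_grad])
    define Q where "Q = (\<lambda>e. q + e *\<^sub>R X + L e *\<^sub>R nrm q)"
    have dQ': "(Q has_vector_derivative (X + L' *\<^sub>R nrm q)) (at 0)"
      using L(3) unfolding Q_def has_real_derivative_iff_has_vector_derivative
        has_vector_derivative_def
      by (auto intro!: derivative_eq_intros simp: algebra_simps)
    have Q0: "Q 0 = q" by (simp add: Q_def L)
    have evQ: "eventually (\<lambda>e. F (Q e) = 0) (nhds 0)" using L(2) by (simp add: Q_def)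
    have "L' = 0"
      using hypersurface_curve(1)[OF dQ' evQ] X nq by (simp add: Q0 inner_add_right)
    then have dQ: "(Q has_vector_derivative X) (at 0)" using dQ' by simp
    note dn = hypersurface_curve(2)[OF dQ evQ, unfolded Q0]
    \<comment> \<open>The fixed vector \<open>u\<close> is projected to the tangent space at
      \<open>Q e\<close> and then normalised. The resulting variation is purely normal, hence
      orthogonal to \<open>q'\<close>.\<close>
    define y where "y = (\<lambda>e. u - (u \<bullet> nrm (Q e)) *\<^sub>R nrm (Q e))"
    have y0: "y 0 = u" using un by (simp add: y_def Q0)
    have "((\<lambda>e. u \<bullet> nrm (Q e)) has_real_derivative u \<bullet> shp q X) (at 0)"
      using has_vector_derivative_inner[OF has_vector_derivative_const[of u] dn] by simp
    then have dy: "(y has_vector_derivative - (u \<bullet> shp q X) *\<^sub>R nrm q) (at 0)"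
      unfolding y_def
      by (auto intro!: derivative_eq_intros dn simp: Q0 un)
    define U where "U = (\<lambda>e. y e /\<^sub>R norm (y e))"
    have "u \<noteq> 0" using nu by auto
    then have dU: "(U has_vector_derivative - (u \<bullet> shp q X) *\<^sub>R nrm q) (at 0)"
      unfolding U_def
      using has_derivative_normalize[OF dy[unfolded has_vector_derivative_def]] nu un
      by (simp add: y0 has_vector_derivative_def)
    have U0: "U 0 = u" using nu by (simp add: U_def y0)
    have "isCont y 0" using dy by (rule has_vector_derivative_continuous)
    then have "eventually (\<lambda>e. y e \<noteq> 0) (at 0)"
      using nu y0 unfolding isCont_def by (metis norm_zero tendsto_imp_eventually_ne zero_neq_one)
    then have "eventually (\<lambda>e. y e \<noteq> 0) (nhds 0)"
      using nu y0 by (auto simp: eventually_nhds_conv_at)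
    with evQ have "eventually (\<lambda>e. F (Q e) = 0 \<and> norm (U e) = 1 \<and> U e \<bullet> nrm (Q e) = 0) (nhds 0)"
    proof eventually_elim
      case (elim e)
      then show ?case
        using nrm_unit[of "Q e"] by (simp add: U_def y_def inner_diff_left)
    qed
    from symp[OF dQ Q0 dU U0 this] show ?thesis using q'(2) by (simp add: inner_commute)
  qed
  \<comment> \<open>The part of \<open>q'\<close> orthogonal to \<open>u\<close> is an admissible
    test vector in \<open>A\<close>, hence orthogonal to itself; \<open>\<zeta>\<close> is treated
    likewise with \<open>B\<close>.\<close>
  define \<eta> where "\<eta> = q' - (q' \<bullet> u) *\<^sub>R u"
  have \<eta>0: "nrm q \<bullet> \<eta> = 0" "u \<bullet> \<eta> = 0"
    using q'(2) un uu by (auto simp: \<eta>_def inner_diff_right inner_commute)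
  have "\<eta> \<bullet> \<eta> = q' \<bullet> \<eta> - (q' \<bullet> u) * (u \<bullet> \<eta>)"
    by (subst (1) \<eta>_def) (simp add: inner_diff_left)
  then have "\<eta> = 0" using A[OF \<eta>0] \<eta>0 by simp
  then show "q' = (q' \<bullet> u) *\<^sub>R u" by (simp add: \<eta>_def)
  define \<zeta> where "\<zeta> = u' - (u' \<bullet> nrm q) *\<^sub>R nrm q"
  have \<zeta>0: "nrm q \<bullet> \<zeta> = 0" using nq by (simp add: \<zeta>_def inner_diff_right inner_commute)
  have "\<zeta> \<bullet> \<zeta> = u' \<bullet> \<zeta> - (u' \<bullet> nrm q) * (nrm q \<bullet> \<zeta>)"
    by (subst (1) \<zeta>_def) (simp add: inner_diff_left)
  then have "\<zeta> = 0" using B[OF \<zeta>0] \<zeta>0 by simp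
  then show "u' = (u' \<bullet> nrm q) *\<^sub>R nrm q" by (simp add: \<zeta>_def)
qed

text \<open>If the end point stood still, the angle condition at \<open>q\<close> and the normality
  of \<open>u'\<close> would give \<open>u' = 0\<close> and \<open>w' = 0\<close>, making
  \<open>d\<close> parallel to \<open>w\<close>. But \<open>d\<close> is a nonzero tangent vector at
  \<open>p\<close>, and \<open>w\<close> is transversal there.\<close>

lemma reflected_velocity_nonzero:
  assumes pq: "F p = 0" "F q = 0" and wp: "w \<bullet> nrm p = - sin \<delta>"
    and d: "nrm p \<bullet> d = 0" "d \<noteq> 0"
    and q': "q' = d + k' *\<^sub>R w + l *\<^sub>R w'"
    and u': "cos \<delta> *\<^sub>R u' = w' - sin \<delta> *\<^sub>R shp q q'" "u' = (u' \<bullet> nrm q) *\<^sub>R nrm q"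
    and wq: "w' \<bullet> nrm q + w \<bullet> shp q q' = 0"
  shows "q' \<noteq> 0"
proof
  assume q0: "q' = 0"
  have "shp q 0 = 0"
    using has_derivative_linear[OF has_derivative_unit_normal[OF grad_nonzero[OF pq(2)]]]
    by (rule linear_0)
  then have 1: "cos \<delta> *\<^sub>R u' = w'" and "w' \<bullet> nrm q = 0" using u'(1) wq q0 by auto
  then have "cos \<delta> * (u' \<bullet> nrm q) = 0" by (metis inner_scaleR_left)
  then have "u' \<bullet> nrm q = 0" using sin_cos_delta by simp
  then have "u' = 0" using u'(2) by simp
  then have "w' = 0" using 1 by simp
  then have "d = - k' *\<^sub>R w" using q' q0 by (simp add: eq_neg_iff_add_eq_0)
  moreover from this have "k' * sin \<delta> = 0" using d(1) wp by (simp add: inner_commute)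
  ultimately show False using d(2) sin_cos_delta by simp
qed

section \<open>Planarity of geodesics tangent to a principal direction\<close>

lemma principal_geodesic_planar:
  fixes \<gamma> :: "real \<Rightarrow> 'a" and a b t0 :: real
  assumes geo: "geodesic_on F {a<..<b} \<gamma>" and t0: "t0 \<in> {a<..<b}"
    and princ: "principal_direction F (\<gamma> t0) (velocity \<gamma> t0)"
  shows "\<forall>t\<in>{a<..<b}. \<gamma> t - \<gamma> t0 \<in> span {velocity \<gamma> t0, nrm (\<gamma> t0)}"
    and "\<forall>t\<in>{a<..<b}. principal_direction F (\<gamma> t) (velocity \<gamma> t)"
proof -
  define I where "I = {a<..<b}"
  define s c where "s = sin \<delta>" and "c = cos \<delta>"
  have sc: "s > 0" "c > 0" "s * s + c * c = 1"
    using sin_cos_delta sin_cos_delta_squares by (auto simp: s_def c_def)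
  have oI: "open I" by (simp add: I_def)
  have t0I: "t0 \<in> I" using t0 by (simp add: I_def)
  have near: "eventually (\<lambda>t. t \<in> I) (nhds t)" if "t \<in> I" for t
    using eventually_nhds_in_open[OF oI that] .
  have smooth\<gamma>: "C_infinity_on I \<gamma>" using geo by (simp add: geodesic_on_def I_def)
  have F0: "F (\<gamma> t) = 0" if "t \<in> I" for t
    using geo that by (simp add: geodesic_on_def I_def hsurf_def)

  define d where "d = velocity \<gamma>"
  define acc where "acc = acceleration \<gamma>"
  note d\<gamma> = C_infinity_on_curve(1)[OF smooth\<gamma> oI, folded d_def]
  note dd = C_infinity_on_curve(2)[OF smooth\<gamma> oI, folded d_def acc_def]
  note acc_cont = C_infinity_on_curve(3)[OF smooth\<gamma> oI, folded acc_def]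
  define n where "n = (\<lambda>t. nrm (\<gamma> t))"
  define n' where "n' = (\<lambda>t. shp (\<gamma> t) (d t))"
  have ev\<gamma>: "eventually (\<lambda>t. F (\<gamma> t) = 0) (nhds t)" if "t \<in> I" for t
    using near[OF that] by eventually_elim (simp add: F0)
  have nd: "n t \<bullet> d t = 0" if "t \<in> I" for t
    unfolding n_def by (rule hypersurface_curve(1)[OF d\<gamma>[OF that] ev\<gamma>[OF that]])
  have dn: "(n has_vector_derivative n' t) (at t)" if "t \<in> I" for t
    unfolding n_def n'_def by (rule hypersurface_curve(2)[OF d\<gamma>[OF that] ev\<gamma>[OF that]])
  have nn: "n t \<bullet> n t = 1" if "t \<in> I" for t
    unfolding n_def by (rule nrm_unit[OF F0[OF that]])
  have acc_n: "acc t = (acc t \<bullet> n t) *\<^sub>R n t" if "t \<in> I" for t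
  proof -
    \<comment> \<open>The tangential part of the acceleration is itself a test vector in the
      geodesic condition.\<close>
    define z where "z = acc t - (acc t \<bullet> n t) *\<^sub>R n t"
    have nz: "n t \<bullet> z = 0" using nn[OF that] by (simp add: z_def inner_diff_right inner_commute)
    then have "z \<in> tangent_space F (\<gamma> t)"
      using grad_inner_zero_iff[OF grad_nonzero[OF F0[OF that]], of z]
      by (simp add: tangent_space_iff n_def)
    then have "acc t \<bullet> z = 0" using geo that by (simp add: geodesic_on_def I_def acc_def)
    moreover have "z \<bullet> z = acc t \<bullet> z - (acc t \<bullet> n t) * (n t \<bullet> z)"
      by (subst (1) z_def) (simp add: inner_diff_left)
    ultimately have "z = 0" using nz by simp
    then show ?thesis by (simp add: z_def)
  qed

  \<comment> \<open>Normal acceleration preserves the speed, so dividing by the positive initial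
    speed gives unit vectors throughout.\<close>
  define \<sigma> where "\<sigma> = norm (d t0)"
  have \<sigma>: "\<sigma> > 0" using princ by (simp add: principal_direction_def \<sigma>_def d_def)
  have speed: "d t \<bullet> d t = \<sigma> * \<sigma>" if "t \<in> I" for t
  proof -
    have "((\<lambda>t. d t \<bullet> d t) has_real_derivative 0) (at r)" if "r \<in> I" for r
    proof -
      have "acc r \<bullet> d r = (acc r \<bullet> n r) * (n r \<bullet> d r)"
        using acc_n[OF that] by (metis inner_scaleR_left)
      then have "acc r \<bullet> d r = 0" using nd[OF that] by simp
      then show ?thesis
        using has_vector_derivative_inner[OF dd[OF that] dd[OF that]] by (simp add: inner_commute)
    qed
    then have "d t \<bullet> d t = d t0 \<bullet> d t0"
      using that t0I t0 DERIV_isconst3[of a b t t0 "\<lambda>t. d t \<bullet> d t"] by (auto simp: I_def)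
    then show ?thesis by (simp add: \<sigma>_def power2_norm_eq_inner[symmetric] power2_eq_square)
  qed
  have d_ne: "d t \<noteq> 0" if "t \<in> I" for t using speed[OF that] \<sigma> by auto

  define v where "v = (\<lambda>t. d t /\<^sub>R \<sigma>)"
  define \<alpha> where "\<alpha> = (\<lambda>t. (acc t \<bullet> n t) / \<sigma>)"
  have dv: "(v has_vector_derivative \<alpha> t *\<^sub>R n t) (at t)" if "t \<in> I" for t
  proof -
    have "(v has_vector_derivative acc t /\<^sub>R \<sigma>) (at t)"
      unfolding v_def using dd[OF that] by (auto intro!: derivative_eq_intros)
    moreover have "acc t /\<^sub>R \<sigma> = \<alpha> t *\<^sub>R n t"
      by (subst acc_n[OF that]) (simp add: \<alpha>_def divide_inverse_commute)
    ultimately show ?thesis by simp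
  qed
  have vv: "v t \<bullet> v t = 1" and vn: "v t \<bullet> n t = 0" if "t \<in> I" for t
    using speed[OF that] nd[OF that] \<sigma> by (auto simp: v_def inner_commute field_simps)
  \<comment> \<open>The normal points outwards, so the minus sign makes \<open>w\<close> enter the
    domain.\<close>
  define w where "w = (\<lambda>t. c *\<^sub>R v t - s *\<^sub>R n t)"
  define w' where "w' = (\<lambda>t. (c * \<alpha> t) *\<^sub>R n t - s *\<^sub>R n' t)"
  have dw: "(w has_vector_derivative w' t) (at t)" if "t \<in> I" for t
    unfolding w_def w'_def using dv[OF that] dn[OF that] by (auto intro!: derivative_eq_intros)
  have ww: "w t \<bullet> w t = 1" if "t \<in> I" for t
    using vv[OF that] vn[OF that] nn[OF that] sc(3)
    by (simp add: w_def inner_diff_left inner_diff_right inner_commute)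
  have nw: "norm (w t) = 1" if "t \<in> I" for t using ww[OF that] by (simp add: norm_eq_1)
  have wn: "w t \<bullet> n t = - s" if "t \<in> I" for t
    using vn[OF that] nn[OF that] by (simp add: w_def inner_diff_left)

  define L where "L = (\<lambda>t. chord (\<gamma> t) (w t))"
  define q where "q = (\<lambda>t. \<gamma> t + L t *\<^sub>R w t)"
  define m where "m = (\<lambda>t. nrm (q t))"
  have L: "L t > 0" and Fq: "F (q t) = 0" and wm: "w t \<bullet> m t = s" if "t \<in> I" for t
    using chord_props[OF F0[OF that] nw[OF that] wn[OF that, unfolded n_def s_def]]
    by (auto simp: L_def q_def m_def s_def)
  have "\<exists>k. (L has_real_derivative k) (at t)" if "t \<in> I" for t
  proof -
    have "eventually (\<lambda>t. F (\<gamma> t) = 0 \<and> norm (w t) = 1 \<and> w t \<bullet> nrm (\<gamma> t) = - sin \<delta>) (nhds t)"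
      using near[OF that]
    proof eventually_elim
      case (elim r)
      then show ?case using F0 nw wn by (simp add: n_def s_def)
    qed
    from chord_differentiable[OF d\<gamma>[OF that] dw[OF that] this] show ?thesis
      unfolding L_def by blast
  qed
  then obtain L' where dL: "\<And>t. t \<in> I \<Longrightarrow> (L has_real_derivative L' t) (at t)" by metis
  define q' where "q' = (\<lambda>t. d t + L' t *\<^sub>R w t + L t *\<^sub>R w' t)"
  have dq: "(q has_vector_derivative q' t) (at t)" if "t \<in> I" for t
    unfolding q_def q'_def
    by (rule derivative_eq_intros d\<gamma>[OF that] dw[OF that] dL[OF that] refl
        has_vector_derivative_scaleR)+ simp
  have evq: "eventually (\<lambda>t. F (q t) = 0) (nhds t)" if "t \<in> I" for t
    using near[OF that] by eventually_elim (simp add: Fq)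
  have mq': "m t \<bullet> q' t = 0" if "t \<in> I" for t
    unfolding m_def by (rule hypersurface_curve(1)[OF dq[OF that] evq[OF that]])
  define m' where "m' = (\<lambda>t. shp (q t) (q' t))"
  have dm: "(m has_vector_derivative m' t) (at t)" if "t \<in> I" for t
    unfolding m_def m'_def by (rule hypersurface_curve(2)[OF dq[OF that] evq[OF that]])
  define u where "u = (\<lambda>t. (w t - s *\<^sub>R m t) /\<^sub>R c)"
  define u' where "u' = (\<lambda>t. (w' t - s *\<^sub>R m' t) /\<^sub>R c)"
  have du: "(u has_vector_derivative u' t) (at t)" if "t \<in> I" for t
    unfolding u_def u'_def using dw[OF that] dm[OF that] by (auto intro!: derivative_eq_intros)
  have ww': "w t \<bullet> w' t = 0" if "t \<in> I" for t
  proof -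
    have "w' t \<bullet> w t + w t \<bullet> w' t = 0"
      by (rule DERIV_eventually_const[OF has_vector_derivative_inner[OF dw[OF that] dw[OF that]], where k = 1])
         (use near[OF that] ww in \<open>auto elim: eventually_mono\<close>)
    then show ?thesis by (simp add: inner_commute)
  qed
  have wm': "w' t \<bullet> m t + w t \<bullet> m' t = 0" if "t \<in> I" for t
    by (rule DERIV_eventually_const[OF has_vector_derivative_inner[OF dw[OF that] dm[OF that]], where k = s])
       (use near[OF that] wm in \<open>auto elim: eventually_mono\<close>)
  have refl: "q' t = (q' t \<bullet> u t) *\<^sub>R u t" "u' t = (u' t \<bullet> m t) *\<^sub>R m t" "norm (u t) = 1" "u t \<bullet> m t = 0"
    if "t \<in> I" for t
  proof -
    have 1: "c *\<^sub>R d t = \<sigma> *\<^sub>R (w t + s *\<^sub>R n t)" using \<sigma> by (simp add: w_def v_def)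
    have 2: "w' t = (c * \<alpha> t) *\<^sub>R n t - s *\<^sub>R shp (\<gamma> t) (d t)" by (simp add: w'_def n'_def)
    have 3: "q' t = d t + L' t *\<^sub>R w t + L t *\<^sub>R w' t" by (simp add: q'_def)
    have 4: "c *\<^sub>R u t = w t - s *\<^sub>R m t" "c *\<^sub>R u' t = w' t - s *\<^sub>R shp (q t) (q' t)"
      using sc by (simp_all add: u_def u'_def m'_def)
    have 5: "q t = \<gamma> t + L t *\<^sub>R w t" by (simp add: q_def)
    show "q' t = (q' t \<bullet> u t) *\<^sub>R u t" "u' t = (u' t \<bullet> m t) *\<^sub>R m t" "norm (u t) = 1" "u t \<bullet> m t = 0"
      using reflected_geodesic[OF F0[OF that] Fq[OF that] L[OF that] 5 nw[OF that]
          wm[OF that, unfolded m_def s_def] ww'[OF that] 1[unfolded c_def s_def n_def]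
          nd[OF that, unfolded n_def] 2[unfolded s_def n_def] 3 mq'[OF that, unfolded m_def]
          4[unfolded c_def s_def m_def]]
      by (simp_all add: m_def)
  qed
  \<comment> \<open>This will allow \<open>u t0 \<bullet> z = 0\<close> to be read off from
    \<open>q' t0 \<bullet> z = 0\<close>.\<close>
  have q'0: "q' t0 \<noteq> 0"
  proof (rule reflected_velocity_nonzero[OF F0[OF t0I] Fq[OF t0I]])
    show "w t0 \<bullet> nrm (\<gamma> t0) = - sin \<delta>" using wn[OF t0I] by (simp add: n_def s_def)
    show "nrm (\<gamma> t0) \<bullet> d t0 = 0" using nd[OF t0I] by (simp add: n_def)
    show "d t0 \<noteq> 0" using d_ne[OF t0I] .
    show "q' t0 = d t0 + L' t0 *\<^sub>R w t0 + L t0 *\<^sub>R w' t0" by (simp add: q'_def)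
    show "cos \<delta> *\<^sub>R u' t0 = w' t0 - sin \<delta> *\<^sub>R shp (q t0) (q' t0)"
      using sc by (simp add: u'_def m'_def s_def c_def)
    show "u' t0 = (u' t0 \<bullet> nrm (q t0)) *\<^sub>R nrm (q t0)" using refl(2)[OF t0I] by (simp add: m_def)
    show "w' t0 \<bullet> nrm (q t0) + w t0 \<bullet> shp (q t0) (q' t0) = 0"
      using wm'[OF t0I] by (simp add: m_def m'_def)
  qed

  \<comment> \<open>The coefficients of the linear system are shown to be continuous, so that
    \<open>M\<close> below qualifies for \<open>gronwall_zero\<close>.\<close>
  have cont: "continuous_on I f" if "\<And>t. t \<in> I \<Longrightarrow> (f has_vector_derivative f' t) (at t)"
    for f f' :: "real \<Rightarrow> 'a"
    using that by (auto intro!: continuous_at_imp_continuous_on has_vector_derivative_continuous)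
  have c\<gamma>: "continuous_on I \<gamma>" and cd: "continuous_on I d" and cn: "continuous_on I n"
    and cw: "continuous_on I w" and cq: "continuous_on I q" and cm: "continuous_on I m"
    and cu: "continuous_on I u"
    using cont[OF d\<gamma>] cont[OF dd] cont[OF dn] cont[OF dw] cont[OF dq] cont[OF dm] cont[OF du]
    by blast+
  have cL: "continuous_on I L"
    using dL by (auto intro!: continuous_at_imp_continuous_on DERIV_isCont)
  have c\<alpha>: "continuous_on I \<alpha>"
    unfolding \<alpha>_def using acc_cont cn \<sigma> by (intro continuous_intros) auto
  have cn': "continuous_on I n'"
    unfolding n'_def using c\<gamma> cd grad_nonzero[OF F0] by (rule continuous_on_shape_operator)
  have cw': "continuous_on I w'"
    unfolding w'_def using c\<alpha> cn cn' by (intro continuous_intros)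
  \<comment> \<open>\<open>L'\<close> was chosen pointwise; solving
    \<open>m t \<bullet> q' t = 0\<close> for it, with \<open>w t \<bullet> m t = s\<close> nonzero,
    shows its continuity.\<close>
  have "L' t = - (m t \<bullet> (d t + L t *\<^sub>R w' t)) / s" if "t \<in> I" for t
    using mq'[OF that] wm[OF that] sc
    by (simp add: q'_def inner_add_right inner_commute[of "m t" "w t"] field_simps)
  moreover have "continuous_on I (\<lambda>t. - (m t \<bullet> (d t + L t *\<^sub>R w' t)) / s)"
    using cm cd cL cw' sc by (intro continuous_intros) auto
  ultimately have cL': "continuous_on I L'" by (simp cong: continuous_on_cong)
  have cq': "continuous_on I q'"
    unfolding q'_def using cd cL' cw cL cw' by (intro continuous_intros)
  have cm': "continuous_on I m'"
    unfolding m'_def using cq cq' grad_nonzero[OF Fq] by (rule continuous_on_shape_operator)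
  have cu': "continuous_on I u'"
    unfolding u'_def using cw' cm' sc by (intro continuous_intros)
  define \<rho> where "\<rho> = (\<lambda>t. q' t \<bullet> u t)"
  define \<nu> where "\<nu> = (\<lambda>t. u' t \<bullet> m t)"
  define M where "M = (\<lambda>t. 2 * (\<sigma> + \<bar>\<alpha> t\<bar> * ((c + 2 / L t) / s) + \<bar>\<rho> t\<bar> + \<bar>\<nu> t\<bar> * ((c + 2 / L t) / s)))"
  have cM: "continuous_on I M"
    unfolding M_def \<rho>_def \<nu>_def using c\<alpha> cL cq' cu cu' cm sc L
    by (intro continuous_intros) (auto simp: less_imp_neq[THEN not_sym])

  have plane: "(\<gamma> t - \<gamma> t0) \<bullet> z = 0 \<and> v t \<bullet> z = 0 \<and> n t \<bullet> z = 0"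
    if z: "z \<bullet> d t0 = 0" "z \<bullet> n t0 = 0" and t: "t \<in> I" for z t
  proof -
    define x1 where "x1 = (\<lambda>t. (\<gamma> t - \<gamma> t0) \<bullet> z)"
    define x2 where "x2 = (\<lambda>t. v t \<bullet> z)"
    define x3 where "x3 = (\<lambda>t. (q t - \<gamma> t0) \<bullet> z)"
    define x4 where "x4 = (\<lambda>t. u t \<bullet> z)"
    have wz: "w t \<bullet> z = (x3 t - x1 t) / L t" if "t \<in> I" for t
      using L[OF that] by (simp add: x3_def x1_def q_def inner_diff_left inner_add_left)
    have nz: "n t \<bullet> z = (c * x2 t - (x3 t - x1 t) / L t) / s" if "t \<in> I" for t
      using wz[OF that, symmetric] sc by (simp add: w_def x2_def inner_diff_left)
    have mz: "m t \<bullet> z = ((x3 t - x1 t) / L t - c * x4 t) / s" if "t \<in> I" for t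
      using wz[OF that, symmetric] sc by (simp add: u_def x4_def inner_diff_left field_simps)
    have inner_z: "((\<lambda>t. f t \<bullet> z) has_real_derivative f' \<bullet> z) (at t)"
      if "(f has_vector_derivative f') (at t)" for f f' t
      using has_vector_derivative_inner[OF that has_vector_derivative_const[of z]] by simp
    have dx1: "(x1 has_real_derivative \<sigma> * x2 t) (at t)" if "t \<in> I" for t
    proof -
      have "((\<lambda>t. \<gamma> t - \<gamma> t0) has_vector_derivative d t) (at t)"
        using d\<gamma>[OF that] by (auto intro!: derivative_eq_intros)
      from inner_z[OF this] show ?thesis using \<sigma> by (simp add: x1_def x2_def v_def field_simps)
    qed
    have dx2: "(x2 has_real_derivative \<alpha> t * ((c * x2 t - (x3 t - x1 t) / L t) / s)) (at t)"
      if "t \<in> I" for t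
      using inner_z[OF dv[OF that]] unfolding nz[OF that, symmetric] by (simp add: x2_def)
    have dx3: "(x3 has_real_derivative \<rho> t * x4 t) (at t)" if "t \<in> I" for t
    proof -
      have "((\<lambda>t. q t - \<gamma> t0) has_vector_derivative q' t) (at t)"
        using dq[OF that] by (auto intro!: derivative_eq_intros)
      moreover have "q' t \<bullet> z = \<rho> t * x4 t"
        using refl(1)[OF that] unfolding \<rho>_def x4_def by (metis inner_scaleR_left)
      ultimately show ?thesis using inner_z unfolding x3_def by metis
    qed
    have dx4: "(x4 has_real_derivative \<nu> t * (((x3 t - x1 t) / L t - c * x4 t) / s)) (at t)"
      if "t \<in> I" for t
    proof -
      have "u' t \<bullet> z = \<nu> t * (m t \<bullet> z)"
        using refl(2)[OF that] unfolding \<nu>_def by (metis inner_scaleR_left)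
      then show ?thesis
        using inner_z[OF du[OF that]] unfolding mz[OF that, symmetric] by (simp add: x4_def)
    qed
    define E where "E = (\<lambda>t. (x1 t)\<^sup>2 + (x2 t)\<^sup>2 + (x3 t)\<^sup>2 + (x4 t)\<^sup>2)"
    define E' where "E' = (\<lambda>t. 2 * (x1 t * (\<sigma> * x2 t)
      + x2 t * (\<alpha> t * ((c * x2 t - (x3 t - x1 t) / L t) / s)) + x3 t * (\<rho> t * x4 t)
      + x4 t * (\<nu> t * (((x3 t - x1 t) / L t - c * x4 t) / s))))"
    have dE: "(E has_real_derivative E' t) (at t)" if "t \<in> I" for t
    proof -
      have sqd: "((\<lambda>t. (f t)\<^sup>2) has_real_derivative 2 * (f t * f')) (at t)"
        if "(f has_real_derivative f') (at t)" for f f'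
        using that by (auto intro!: derivative_eq_intros)
      show ?thesis
        unfolding E_def E'_def
        using DERIV_add[OF DERIV_add[OF DERIV_add[OF sqd[OF dx1[OF that]] sqd[OF dx2[OF that]]]
              sqd[OF dx3[OF that]]] sqd[OF dx4[OF that]]]
        by (simp only: distrib_left)
    qed
    have leE: "\<bar>E' t\<bar> \<le> M t * E t" if "t \<in> I" for t
      unfolding E'_def M_def E_def
      using quadratic_energy_bound[OF sc(1,2) L[OF that] \<sigma>] .
    have z0: "d t0 \<bullet> z = 0" "v t0 \<bullet> z = 0" "n t0 \<bullet> z = 0" "w t0 \<bullet> z = 0"
      using z by (auto simp: inner_commute v_def w_def inner_diff_right)
    \<comment> \<open>The principal direction enters here: \<open>n' t0\<close> is a multiple of
      \<open>d t0\<close>.\<close>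
    have "n' t0 \<bullet> z = 0"
    proof -
      obtain k where "shp (\<gamma> t0) (d t0) = k *\<^sub>R d t0"
        using princ by (auto simp: principal_direction_def d_def)
      then show ?thesis using z0 by (simp add: n'_def)
    qed
    then have "q' t0 \<bullet> z = 0"
      using z0 by (simp add: q'_def w'_def inner_add_left inner_diff_left)
    moreover have "q' t0 \<bullet> z = \<rho> t0 * x4 t0"
      using refl(1)[OF t0I] unfolding \<rho>_def x4_def by (metis inner_scaleR_left)
    moreover have "\<rho> t0 \<noteq> 0" using q'0 refl(1)[OF t0I] by (auto simp: \<rho>_def)
    ultimately have "x4 t0 = 0" by simp
    then have E0: "E t0 = 0"
      using z0 by (simp add: E_def x1_def x2_def x3_def q_def)
    have "E t = 0"
      by (rule gronwall_zero[of t0 a b t E E' M])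
         (use t0I t dE leE cM E0 in \<open>auto simp: I_def E_def\<close>)
    then have x0: "x1 t = 0 \<and> x2 t = 0 \<and> x3 t = 0"
      unfolding E_def by (smt (verit) zero_le_power2 zero_eq_power2)
    then show ?thesis
      using nz[OF t] by (simp add: x1_def x2_def)
  qed

  show "\<forall>t\<in>{a<..<b}. \<gamma> t - \<gamma> t0 \<in> span {velocity \<gamma> t0, nrm (\<gamma> t0)}"
    using plane by (auto intro!: in_span_pairI simp: I_def d_def n_def)
  have "principal_direction F (\<gamma> t) (d t)" if t: "t \<in> I" for t
  proof -
    have ne: "d t \<noteq> 0" "n t \<noteq> 0" using d_ne[OF t] nn[OF t] by auto
    have "v t \<in> span {d t0, n t0}" "n t \<in> span {d t0, n t0}"
      using plane t by (auto intro!: in_span_pairI)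
    then have "d t \<in> span {d t0, n t0}" "n t \<in> span {d t0, n t0}"
      using span_scale[of "v t" "{d t0, n t0}" \<sigma>] \<sigma> by (auto simp: v_def)
    then have span_eq: "span {d t, n t} = span {d t0, n t0}"
      using ne nd[OF t] by (intro span_orthogonal_pair_eq) (auto simp: inner_commute)
    \<comment> \<open>For \<open>z\<close> orthogonal to the initial plane, the product of
      \<open>n\<close> with \<open>z\<close> vanishes at all times near \<open>t\<close>, and so
      does its derivative.\<close>
    have "n' t \<in> span {d t0, n t0}"
    proof (rule in_span_pairI)
      fix z assume z: "z \<bullet> d t0 = 0" "z \<bullet> n t0 = 0"
      have "((\<lambda>t. n t \<bullet> z) has_real_derivative n' t \<bullet> z) (at t)"
        using has_vector_derivative_inner[OF dn[OF t] has_vector_derivative_const[of z]] by simp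
      then show "n' t \<bullet> z = 0"
        by (rule DERIV_eventually_const[where k = 0])
           (use near[OF t] plane[OF z] in \<open>auto elim: eventually_mono\<close>)
    qed
    then have "n' t \<in> span {d t, n t}" by (simp add: span_eq)
    then obtain k k' where n'_eq: "n' t = k *\<^sub>R d t + k' *\<^sub>R n t"
      by (auto simp: span_insert algebra_simps span_singleton)
    have "n t \<bullet> n' t = 0" unfolding n_def n'_def by (rule nrm_shp[OF F0[OF t]])
    then have "k' = 0" using n'_eq nd[OF t] nn[OF t] by (simp add: inner_add_right)
    then have "shp (\<gamma> t) (d t) = k *\<^sub>R d t" using n'_eq by (simp add: n'_def)
    moreover have "d t \<in> tangent_space F (\<gamma> t)"
      using nd[OF t] grad_inner_zero_iff[OF grad_nonzero[OF F0[OF t]], of "d t"]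
      by (simp add: tangent_space_iff n_def)
    ultimately show ?thesis using ne by (auto simp: principal_direction_def)
  qed
  then show "\<forall>t\<in>{a<..<b}. principal_direction F (\<gamma> t) (velocity \<gamma> t)"
    by (simp add: I_def d_def)
qed

end

theorem theorem2p5:
  fixes F :: "'a::euclidean_space \<Rightarrow> real" and \<gamma> :: "real \<Rightarrow> 'a" and a b t0 :: real
  assumes "gutkin_table F"
    and "a < b" and "geodesic_on F {a<..<b} \<gamma>"
    and "t0 \<in> {a<..<b}"
    and "principal_direction F (\<gamma> t0) (velocity \<gamma> t0)"
  shows "(\<forall>t\<in>{a<..<b}. \<gamma> t - \<gamma> t0 \<in> span {velocity \<gamma> t0, unit_normal F (\<gamma> t0)})
    \<and> (\<forall>t\<in>{a<..<b}. principal_direction F (\<gamma> t) (velocity \<gamma> t))"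
proof -
  obtain \<delta> where \<delta>: "0 < \<delta>" "\<delta> < pi / 2"
    "\<forall>p\<in>hsurf F. \<forall>q\<in>hsurf F. p \<noteq> q \<longrightarrow>
       angle_to_hyperplane (q - p) (unit_normal F p) = \<delta> \<longrightarrow>
       angle_to_hyperplane (q - p) (unit_normal F q) = \<delta>"
    and F: "smooth_convex_hypersurface F"
    using assms(1) unfolding gutkin_table_def by blast
  interpret gutkin_billiard F \<delta>
    by unfold_locales (use F \<delta> in \<open>auto simp: smooth_convex_hypersurface_def hsurf_def\<close>)
  show ?thesis using principal_geodesic_planar[OF assms(3-5)] by blast
qed

end
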